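(* Let $S=\{v_1,\dots,v_m\}\subset\mathbb Z^n$ be generic. There is a non-empty open set of parameters $\xi\in\{\xi\in\mathbb R^m:\xi_i>0\ \forall i\}$ for which all the eigenvalues of $Q$ are real.
   Context: Generic: $P(v_1,\dots,v_m)\ne0$ for a suitable nonzero real polynomial $P$ in the coordinates of $(v_1,\dots,v_m)\in(\mathbb R^n)^m$, depending only on $m,n$; the claim asserts that such a $P$ exists. (For generic $S$ all components of the graph $\Lambda_S$ below are finite; this is known.) $e_1,\dots,e_m$ is the standard basis of $\mathbb Z^m$; $\eta:\mathbb Z^m\to\mathbb Z$ is linear with $\eta(e_i)=1$. $G=\mathbb Z^m\rtimes\mathbb Z/(2)$ consists of elements $a=(a,+)$ and $a\tau=(a,-)$, $a\in\mathbb Z^m$, with $\tau^2=1$, $\tau a=(-a)\tau$. Let $X=\{e_i-e_j: i\ne j\}\cup\{(-e_i-e_j)\tau: i\neq j\}$. In the Cayley graph $G_X$, $u,v\in G$ are joined by an edge marked $x\in X$ when $v=xu$. Let $\pi:\mathbb Z^m\to\mathbb Z^n$ be linear with $\pi(e_i)=v_i$, $\Theta=\ker\pi$, and for $u=(a,\sigma)$, $a=\sum a_ie_i$, put $K(u)=\frac{\sigma}{2}\big(|\sum_i a_iv_i|^2+\sum_i a_i|v_i|^2\big)$. Let $G^1=\{a,a\tau:\eta(a)=-1\}$. The graph $\Lambda_S$ has vertex set $G^1\setminus\bigcup_i\{(-e_i+\Theta),(-e_i+\Theta)\tau\}$ and as edges those edges of $G_X$ between such vertices $u,v$ with $K(u)=K(v)$.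 $Q$ is the operator with matrix (indexed by the vertices of $\Lambda_S$) $Q_{a,a}=K(a)-\sum_j a_j\xi_j$, $Q_{a\tau,a\tau}=K(a\tau)+\sum_j a_j\xi_j$; $Q_{a,b}=2\sqrt{\xi_i\xi_j}$, $Q_{a\tau,b\tau}=-2\sqrt{\xi_i\xi_j}$ if the two vertices are joined in $\Lambda_S$ by an edge marked $e_i-e_j$; $Q_{a,b\tau}=-2\sqrt{\xi_i\xi_j}$, $Q_{b\tau,a}=2\sqrt{\xi_i\xi_j}$ if $a,b\tau$ are joined in $\Lambda_S$ by an edge marked $(-e_i-e_j)\tau$; other entries $0$. (This is the matrix of $-\tfrac12\mathrm i\,\mathrm{ad}(N)$ in the frequency basis, for the quadratic normal form $N$ of the cubic NLS with tangential sites $S$.) $Q$ is the direct sum of finite blocks indexed by the connected components of $\Lambda_S$, and its eigenvalues are the eigenvalues of all these blocks. *)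

theory Defs
  imports "HOL-Analysis.Analysis" "HOL-Library.Poly_Mapping"
begin

text \<open>A polynomial in the variables \<open>'v\<close> is a finitely supported map from monomials to
  coefficients, a monomial being a finitely supported map from variables to exponents.\<close>

type_synonym 'v mpoly_real = "('v \<Rightarrow>\<^sub>0 nat) \<Rightarrow>\<^sub>0 real"

definition mpoly_eval :: "'v mpoly_real \<Rightarrow> ('v \<Rightarrow> real) \<Rightarrow> real" where
  "mpoly_eval P x = (\<Sum>t\<in>Poly_Mapping.keys P. Poly_Mapping.lookup P t *
     (\<Prod>i\<in>Poly_Mapping.keys t. x i ^ Poly_Mapping.lookup t i))"

text \<open>\<open>Pos a\<close> is the element \<open>a = (a,+)\<close> and \<open>Neg a\<close> is \<open>a\<tau> = (a,-)\<close>.\<close>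

datatype ('m::finite) grp = Pos "int ^ 'm" | Neg "int ^ 'm"

text \<open>The products follow from \<open>\<tau>\<^sup>2 = 1\<close> and \<open>\<tau> b = (-b) \<tau>\<close>.\<close>

fun gmult :: "('m::finite) grp \<Rightarrow> 'm grp \<Rightarrow> 'm grp"  (infixl \<open>\<cdot>\<^sub>G\<close> 70) where
  "Pos a \<cdot>\<^sub>G Pos b = Pos (a + b)"
| "Pos a \<cdot>\<^sub>G Neg b = Neg (a + b)"
| "Neg a \<cdot>\<^sub>G Pos b = Neg (a - b)"
| "Neg a \<cdot>\<^sub>G Neg b = Pos (a - b)"

lemma gmult_assoc: "(x \<cdot>\<^sub>G y) \<cdot>\<^sub>G z = x \<cdot>\<^sub>G (y \<cdot>\<^sub>G z)"
  by (cases x; cases y; cases z) simp_all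

fun translation_part :: "('m::finite) grp \<Rightarrow> int ^ 'm" where
  "translation_part (Pos a) = a"
| "translation_part (Neg a) = a"

fun gsign :: "('m::finite) grp \<Rightarrow> int" where
  "gsign (Pos a) = 1"
| "gsign (Neg a) = -1"

abbreviation std :: "'m::finite \<Rightarrow> int ^ 'm" where
  "std i \<equiv> axis i 1"

definition \<eta> :: "int ^ ('m::finite) \<Rightarrow> int" where
  "\<eta> a = (\<Sum>i\<in>UNIV. a $ i)"

definition black :: "'m::finite \<Rightarrow> 'm \<Rightarrow> 'm grp" where
  "black i j = Pos (std i - std j)"

definition red :: "'m::finite \<Rightarrow> 'm \<Rightarrow> 'm grp" where
  "red i j = Neg (- std i - std j)"

definition X_marks :: "('m::finite) grp set" where
  "X_marks = {black i j | i j. i \<noteq> j} \<union> {red i j | i j. i \<noteq> j}"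

text \<open>The tangential sites \<open>v\<^sub>1, \<dots>, v\<^sub>m \<in> \<int>\<^sup>n\<close> are the rows \<open>v $ i\<close> of \<open>v\<close>.\<close>

definition \<pi>\<^sub>S :: "int ^ 'n ^ 'm \<Rightarrow> int ^ 'm \<Rightarrow> int ^ ('n::finite)" where
  "\<pi>\<^sub>S v a = (\<Sum>i\<in>(UNIV::('m::finite) set). a $ i *s v $ i)"

definition \<Theta> :: "int ^ ('n::finite) ^ ('m::finite) \<Rightarrow> (int ^ 'm) set" where
  "\<Theta> v = {a. \<pi>\<^sub>S v a = 0}"

definition sqnorm :: "int ^ ('n::finite) \<Rightarrow> int" where
  "sqnorm x = (\<Sum>k\<in>UNIV. (x $ k)\<^sup>2)"

definition K :: "int ^ ('n::finite) ^ ('m::finite) \<Rightarrow> 'm grp \<Rightarrow> real" where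
  "K v u = (let a = translation_part u in
     of_int (gsign u) / 2 * of_int (sqnorm (\<pi>\<^sub>S v a) + (\<Sum>i\<in>UNIV. a $ i * sqnorm (v $ i))))"

definition G1 :: "('m::finite) grp set" where
  "G1 = {u. \<eta> (translation_part u) = -1}"

definition vertices :: "int ^ ('n::finite) ^ ('m::finite) \<Rightarrow> 'm grp set" where
  "vertices v = G1 - (\<Union>i. {u. \<exists>\<theta>\<in>\<Theta> v. translation_part u = - std i + \<theta>})"

definition edge :: "int ^ ('n::finite) ^ ('m::finite) \<Rightarrow> 'm grp \<Rightarrow> 'm grp \<Rightarrow> 'm grp \<Rightarrow> bool" where
  "edge v x u w \<longleftrightarrow> x \<in> X_marks \<and> w = x \<cdot>\<^sub>G u \<and> u \<in> vertices v \<and> w \<in> vertices v \<and> K v u = K v w"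

definition adj :: "int ^ ('n::finite) ^ ('m::finite) \<Rightarrow> ('m grp \<times> 'm grp) set" where
  "adj v = {(u, w). \<exists>x. edge v x u w}"

lemma sym_adj: "sym (adj v)"
proof (rule symI)
  fix u w assume "(u, w) \<in> adj v"
  then obtain x where x: "edge v x u w" by (auto simp: adj_def)
  then consider i j where "i \<noteq> j" "x = black i j" | i j where "i \<noteq> j" "x = red i j"
    by (auto simp: edge_def X_marks_def)
  then have "\<exists>y\<in>X_marks. y \<cdot>\<^sub>G (x \<cdot>\<^sub>G u) = u"
  proof cases
    case 1
    then have "black j i \<in> X_marks" by (auto simp: X_marks_def)
    moreover have "black j i \<cdot>\<^sub>G (x \<cdot>\<^sub>G u) = u"
      using 1 by (cases u) (simp_all add: black_def)
    ultimately show ?thesis by blast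
  next
    case 2
    then have "red i j \<in> X_marks" by (auto simp: X_marks_def)
    moreover have "red i j \<cdot>\<^sub>G (x \<cdot>\<^sub>G u) = u"
      using 2 by (cases u) (simp_all add: red_def)
    ultimately show ?thesis by blast
  qed
  then obtain y where "y \<in> X_marks" "y \<cdot>\<^sub>G (x \<cdot>\<^sub>G u) = u" by blast
  then have "edge v y w u" using x by (auto simp: edge_def)
  then show "(w, u) \<in> adj v" by (auto simp: adj_def)
qed

text \<open>By symmetry of \<open>adj v\<close>, reachability along edges is connectedness in the undirected graph.\<close>

definition components :: "int ^ ('n::finite) ^ ('m::finite) \<Rightarrow> 'm grp set set" where
  "components v = (\<lambda>u. {w. (u, w) \<in> (adj v)\<^sup>*}) ` vertices v"

text \<open>\<open>coupling v \<xi> u w\<close> is \<open>2 * sqrt (\<xi>\<^sub>i * \<xi>\<^sub>j)\<close> if \<open>u\<close> and \<open>w\<close> are joined by an edge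
  marked \<open>std i - std j\<close> or \<open>(- std i - std j)\<tau>\<close>, and \<open>0\<close> if they are not joined. The mark determines
  \<open>i, j\<close> up to order, so the value is well defined; see \<open>coupling_black\<close> and \<open>coupling_red\<close> below.\<close>

definition coupling ::
  "int ^ ('n::finite) ^ ('m::finite) \<Rightarrow> real ^ 'm \<Rightarrow> 'm grp \<Rightarrow> 'm grp \<Rightarrow> real" where
  "coupling v \<xi> u w = (if \<exists>x. edge v x u w
     then (THE r. \<exists>i j. i \<noteq> j \<and> (edge v (black i j) u w \<or> edge v (red i j) u w) \<and>
                    r = 2 * sqrt (\<xi> $ i * \<xi> $ j))
     else 0)"

lemma gmult_right_cancel: "x \<cdot>\<^sub>G u = y \<cdot>\<^sub>G u \<longleftrightarrow> x = y"
  by (cases x; cases y; cases u) simp_all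

lemma edge_mark_unique: "edge v x u w \<Longrightarrow> edge v y u w \<Longrightarrow> x = y"
  by (auto simp: edge_def gmult_right_cancel)

lemma black_neq_red: "black i j \<noteq> red k l"
  by (simp add: black_def red_def)

lemma black_eqD:
  assumes "i \<noteq> j" "k \<noteq> l" "black i j = black k l"
  shows "k = i \<and> l = j"
proof -
  have h: "(if p = i then 1 else 0) - (if p = j then 1 else 0) =
           (if p = k then 1 else 0) - (if p = l then 1 else (0::int))" for p
    using assms(3) by (simp add: black_def vec_eq_iff axis_def)
  have "k = i" using h[of i] assms(1) by (simp split: if_split_asm)
  moreover have "l = j" using h[of j] assms(1) by (simp split: if_split_asm)
  ultimately show ?thesis by blast
qed

lemma red_eqD:
  assumes "i \<noteq> j" "k \<noteq> l" "red i j = red k l"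
  shows "k = i \<and> l = j \<or> k = j \<and> l = i"
proof -
  have h: "- (if p = i then 1 else 0) - (if p = j then 1 else 0) =
           - (if p = k then 1 else 0) - (if p = l then 1 else (0::int))" for p
    using assms(3) by (simp add: red_def vec_eq_iff axis_def)
  have "k = i \<or> l = i" using h[of i] assms(1) by (simp split: if_split_asm)
  moreover have "k = j \<or> l = j" using h[of j] assms(1) by (simp split: if_split_asm)
  ultimately show ?thesis using assms(1) by blast
qed

lemma coupling_eqI:
  assumes "i \<noteq> j" "edge v (black i j) u w \<or> edge v (red i j) u w"
    and uniq: "\<And>k l. k \<noteq> l \<Longrightarrow> edge v (black k l) u w \<or> edge v (red k l) u w \<Longrightarrow>
                 k = i \<and> l = j \<or> k = j \<and> l = i"
  shows "coupling v \<xi> u w = 2 * sqrt (\<xi> $ i * \<xi> $ j)"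
proof -
  have "(THE r. \<exists>i j. i \<noteq> j \<and> (edge v (black i j) u w \<or> edge v (red i j) u w) \<and>
      r = 2 * sqrt (\<xi> $ i * \<xi> $ j)) = 2 * sqrt (\<xi> $ i * \<xi> $ j)"
  proof (rule the_equality)
    fix r
    assume "\<exists>k l. k \<noteq> l \<and> (edge v (black k l) u w \<or> edge v (red k l) u w) \<and>
              r = 2 * sqrt (\<xi> $ k * \<xi> $ l)"
    then obtain k l where kl: "k \<noteq> l" "edge v (black k l) u w \<or> edge v (red k l) u w"
      and r: "r = 2 * sqrt (\<xi> $ k * \<xi> $ l)" by blast
    from uniq[OF kl] r show "r = 2 * sqrt (\<xi> $ i * \<xi> $ j)"
      by (elim disjE conjE) (simp_all add: mult.commute)
  qed (use assms(1,2) in blast)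
  moreover have "\<exists>x. edge v x u w" using assms(2) by blast
  ultimately show ?thesis by (simp add: coupling_def)
qed

lemma coupling_black:
  assumes "i \<noteq> j" "edge v (black i j) u w"
  shows "coupling v \<xi> u w = 2 * sqrt (\<xi> $ i * \<xi> $ j)"
proof (rule coupling_eqI[OF assms(1)])
  fix k l assume kl: "k \<noteq> l" "edge v (black k l) u w \<or> edge v (red k l) u w"
  have "black i j = black k l"
    using kl(2) edge_mark_unique[OF assms(2)] black_neq_red by blast
  then show "k = i \<and> l = j \<or> k = j \<and> l = i" using black_eqD[OF assms(1) kl(1)] by blast
qed (use assms in blast)

lemma coupling_red:
  assumes "i \<noteq> j" "edge v (red i j) u w"
  shows "coupling v \<xi> u w = 2 * sqrt (\<xi> $ i * \<xi> $ j)"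
proof (rule coupling_eqI[OF assms(1)])
  fix k l assume kl: "k \<noteq> l" "edge v (black k l) u w \<or> edge v (red k l) u w"
  have "red i j = red k l"
    using kl(2) edge_mark_unique[OF assms(2)] black_neq_red by metis
  then show "k = i \<and> l = j \<or> k = j \<and> l = i" using red_eqD[OF assms(1) kl(1)] by blast
qed (use assms in blast)

fun Q :: "int ^ ('n::finite) ^ ('m::finite) \<Rightarrow> real ^ 'm \<Rightarrow> 'm grp \<Rightarrow> 'm grp \<Rightarrow> real" where
  "Q v \<xi> (Pos a) (Pos b) = (if a = b then K v (Pos a) - (\<Sum>j\<in>UNIV. of_int (a $ j) * \<xi> $ j)
                            else coupling v \<xi> (Pos a) (Pos b))"
| "Q v \<xi> (Neg a) (Neg b) = (if a = b then K v (Neg a) + (\<Sum>j\<in>UNIV. of_int (a $ j) * \<xi> $ j)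
                            else - coupling v \<xi> (Neg a) (Neg b))"
| "Q v \<xi> (Pos a) (Neg b) = - coupling v \<xi> (Pos a) (Neg b)"
| "Q v \<xi> (Neg b) (Pos a) = coupling v \<xi> (Neg b) (Pos a)"

text \<open>Eigenvalues of the block of \<open>Q\<close> on \<open>C\<close>, acting on the complex vector space with basis \<open>C\<close>.
  The support condition holds automatically when \<open>C\<close> is finite, where this is the usual notion for
  a square matrix; it keeps the action of \<open>Q\<close> a finite sum when \<open>C\<close> is infinite.\<close>

definition block_eigenvalue ::
  "int ^ ('n::finite) ^ ('m::finite) \<Rightarrow> real ^ 'm \<Rightarrow> 'm grp set \<Rightarrow> complex \<Rightarrow> bool" where
  "block_eigenvalue v \<xi> C c \<longleftrightarrow>
     (\<exists>f :: 'm grp \<Rightarrow> complex. finite {w. f w \<noteq> 0} \<and> {w. f w \<noteq> 0} \<subseteq> C \<and> (\<exists>w. f w \<noteq> 0) \<and>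
        (\<forall>u\<in>C. (\<Sum>w | f w \<noteq> 0. of_real (Q v \<xi> u w) * f w) = c * f u))"

definition Q_eigenvalues :: "int ^ ('n::finite) ^ ('m::finite) \<Rightarrow> real ^ 'm \<Rightarrow> complex set" where
  "Q_eigenvalues v \<xi> = {c. \<exists>C\<in>components v. block_eigenvalue v \<xi> C c}"

end

theory Submission
  imports Defs "HOL-Computational_Algebra.Polynomial"
begin

text \<open>Genericity is used only to bound the components. The vertices of one sign in a component have
  equal energy, so a linear relation \<open>\<Sum> c\<^sub>g g = 0\<close> among their differences yields
  \<open>\<Sum> c\<^sub>g \<bar>\<pi>(g)\<bar>\<^sup>2 = 0\<close>, and linearly dependent differences admit a relation for which this is not an
  identity in \<open>v\<close>. Hence at most \<open>m + 1\<close> vertices of each sign occur.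

  Attach to \<open>a\<close> and \<open>b\<tau>\<close> the vectors \<open>\<alpha> = a\<close> and \<open>\<alpha> = - b\<close>. On a component \<open>Q\<close> is a scalar plus a matrix
  with diagonal \<open>- \<alpha> \<bullet> \<xi>\<close> and couplings \<open>\<plusminus> 2 sqrt (\<xi>\<^sub>i \<xi>\<^sub>j)\<close> along steps \<open>\<plusminus> e\<^sub>i \<plusminus> e\<^sub>j\<close>, and multiplying it
  by the diagonal matrix of the signs \<open>\<sigma>\<close> makes it symmetric, so an eigenvector with non-real
  eigenvalue satisfies \<open>\<Sum> \<sigma> \<bar>f\<bar>\<^sup>2 = 0\<close>. Choose \<open>\<xi>\<close> hierarchically, each \<open>\<xi>\<^sub>k\<close> much larger than the
  next, and eliminate the largest one by second-order perturbation theory: an eigenvector is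
  concentrated on vertices with the same coefficient of \<open>\<xi>\<^sub>k\<close>. The corrections are products of two even
  couplings over an odd denominator, so every coefficient stays congruent to \<open>- \<alpha>\<^sub>k\<close> modulo 4 in the
  2-adic sense. In the end \<open>f\<close> is concentrated on vertices whose \<open>\<alpha>\<close> agree modulo 4; since
  \<open>\<eta>(\<alpha>) = - \<sigma>\<close>, these all have the same sign, which contradicts \<open>\<Sum> \<sigma> \<bar>f\<bar>\<^sup>2 = 0\<close>.\<close>

section \<open>Second-order perturbation theory\<close>

lemma cmod_sum_mult_le:
  fixes e :: "'a \<Rightarrow> real" and f :: "'a \<Rightarrow> complex"
  assumes "(\<Sum>w\<in>S. \<bar>e w\<bar>) \<le> B" and "\<And>w. w \<in> S \<Longrightarrow> cmod (f w) \<le> p" and "p \<ge> 0"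
  shows "cmod (\<Sum>w\<in>S. of_real (e w) * f w) \<le> B * p"
proof -
  have "cmod (\<Sum>w\<in>S. of_real (e w) * f w) \<le> (\<Sum>w\<in>S. \<bar>e w\<bar> * p)"
    by (rule sum_norm_le) (use assms in \<open>simp add: norm_mult mult_left_mono\<close>)
  also have "\<dots> = (\<Sum>w\<in>S. \<bar>e w\<bar>) * p" by (simp add: sum_distrib_right)
  also have "\<dots> \<le> B * p" using assms by (simp add: mult_right_mono)
  finally show ?thesis .
qed

text \<open>For the matrix \<open>d * y^2 + y * E + F\<close> the gap \<open>g * y^2\<close> between
  levels of \<open>d\<close> dominates the couplings of order \<open>y\<close>, so \<open>f\<close>
  is of order \<open>1 / y\<close> off the level \<open>r\<close>. Substituting the leading part of
  these values back into the equations on the level produces a second-order term of size one. The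
  constants \<open>b\<close> and \<open>C\<close> involve only \<open>B\<close> and
  \<open>g\<close>, so a threshold for \<open>y\<close> can be fixed before \<open>f\<close>,
  \<open>\<mu>\<close> and \<open>u0\<close> are known.\<close>

lemma schur_step:
  fixes d :: "'a \<Rightarrow> real" and E F :: "'a \<Rightarrow> 'a \<Rightarrow> real" and f :: "'a \<Rightarrow> complex"
    and B g y \<delta> r :: real and \<mu> :: complex
  assumes L: "finite L"
    and B: "B \<ge> 0" "\<And>u. u \<in> L \<Longrightarrow> (\<Sum>w\<in>L. \<bar>E u w\<bar>) \<le> B" "\<And>u. u \<in> L \<Longrightarrow> (\<Sum>w\<in>L. \<bar>F u w\<bar>) \<le> B"
    and gap: "g > 0" "\<And>z. z \<in> L \<Longrightarrow> d z \<noteq> r \<Longrightarrow> \<bar>r - d z\<bar> \<ge> g"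
    and E0: "\<And>u w. u \<in> L \<Longrightarrow> w \<in> L \<Longrightarrow> d u = r \<Longrightarrow> d w = r \<Longrightarrow> E u w = 0"
    and f1: "\<And>u. u \<in> L \<Longrightarrow> cmod (f u) \<le> 1"
    and y: "y \<ge> 1" "y \<ge> 2 * (2 * B + 1) / g"
    and \<delta>: "\<delta> \<le> 1"
    and eig: "\<And>u. u \<in> L \<Longrightarrow>
       cmod (of_real (d u * y\<^sup>2) * f u + of_real y * (\<Sum>w\<in>L. of_real (E u w) * f w)
         + (\<Sum>w\<in>L. of_real (F u w) * f w) - \<mu> * f u) \<le> \<delta>"
    and u0: "u0 \<in> L" "cmod (f u0) = 1" "d u0 = r"
  defines "b \<equiv> 2 * B + 1" and "L' \<equiv> {w \<in> L. d w = r}"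
  defines "C \<equiv> B * ((b + 2 * b\<^sup>2 / g) / g) + B * (B * (2 * b / g) / g) + B * (2 * b / g)"
  shows "\<And>z. z \<in> L - L' \<Longrightarrow> cmod (f z) \<le> 2 * b / g / y"
    and "\<And>u. u \<in> L' \<Longrightarrow> cmod ((\<Sum>w\<in>L'. of_real (F u w + (\<Sum>z\<in>L - L'. E u z * E z w / (r - d z))) * f w)
            - (\<mu> - of_real (r * y\<^sup>2)) * f u) \<le> \<delta> + C / y"
proof -
  define EE where "EE u = (\<Sum>w\<in>L. of_real (E u w) * f w)" for u
  define FF where "FF u = (\<Sum>w\<in>L. of_real (F u w) * f w)" for u
  define e where "e u = of_real (d u * y\<^sup>2) * f u + of_real y * EE u + FF u - \<mu> * f u" for u
  have e: "cmod (e u) \<le> \<delta>" if "u \<in> L" for u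
    using eig[OF that] by (simp add: e_def EE_def FF_def)
  have EEb: "cmod (EE u) \<le> B" if "u \<in> L" for u
    unfolding EE_def using cmod_sum_mult_le[of "E u" L B f 1] B(2)[OF that] f1 by simp
  have FFb: "cmod (FF u) \<le> B" if "u \<in> L" for u
    unfolding FF_def using cmod_sum_mult_le[of "F u" L B f 1] B(3)[OF that] f1 by simp
  have b: "b \<ge> 1" using B(1) by (simp add: b_def)
  have y0: "y > 0" using y(1) by linarith
  have eq: "(\<mu> - of_real (d u * y\<^sup>2)) * f u = of_real y * EE u + FF u - e u" for u
    by (simp add: e_def algebra_simps)
  have rhs: "cmod (of_real y * EE u + FF u - e u) \<le> b * y" if "u \<in> L" for u
  proof -
    have "cmod (of_real y * EE u + FF u - e u) \<le> cmod (of_real y * EE u) + cmod (FF u) + cmod (e u)"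
      by (meson norm_triangle_ineq norm_triangle_ineq4 order_trans add_right_mono)
    also have "\<dots> \<le> y * B + B + 1"
      using EEb[OF that] FFb[OF that] e[OF that] \<delta> y0 by (intro add_mono) (auto simp: norm_mult)
    also have "\<dots> \<le> b * y"
    proof -
      have "0 \<le> (y - 1) * (B + 1)" using y(1) B(1) by simp
      then show ?thesis by (simp add: b_def algebra_simps)
    qed
    finally show ?thesis .
  qed
  \<comment> \<open>Since \<open>f u0\<close> has modulus one, the equation at \<open>u0\<close>
    locates \<open>\<mu>\<close> within \<open>b * y\<close> of \<open>r * y^2\<close>, hence at
    distance at least \<open>g * y^2 / 2\<close> from every other level.\<close>
  have mu: "cmod (\<mu> - of_real (r * y\<^sup>2)) \<le> b * y"
    using rhs[OF u0(1)] eq[of u0] u0 by (metis mult.right_neutral norm_mult)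
  show off: "cmod (f z) \<le> 2 * b / g / y" if z: "z \<in> L - L'" for z
  proof -
    have zL: "z \<in> L" and zr: "d z \<noteq> r" using z by (auto simp: L'_def)
    have "of_real ((r - d z) * y\<^sup>2) = (\<mu> - of_real (d z * y\<^sup>2)) - (\<mu> - of_real (r * y\<^sup>2))"
      by (simp add: algebra_simps)
    then have "cmod (of_real ((r - d z) * y\<^sup>2)) \<le> cmod (\<mu> - of_real (d z * y\<^sup>2)) + cmod (\<mu> - of_real (r * y\<^sup>2))"
      by (metis norm_triangle_ineq4)
    moreover have "cmod (of_real ((r - d z) * y\<^sup>2)) \<ge> g * y\<^sup>2"
      using gap(2)[OF zL zr] y0 unfolding norm_of_real abs_mult by (simp add: mult_right_mono)
    moreover have "b * y \<le> g * y\<^sup>2 / 2"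
    proof -
      have "2 * b \<le> g * y" using y(2) gap(1) by (simp add: b_def field_simps)
      then show ?thesis using y0 by (simp add: power2_eq_square)
    qed
    ultimately have low: "cmod (\<mu> - of_real (d z * y\<^sup>2)) \<ge> g * y\<^sup>2 / 2" using mu by linarith
    have "g * y\<^sup>2 / 2 * cmod (f z) \<le> cmod ((\<mu> - of_real (d z * y\<^sup>2)) * f z)"
      unfolding norm_mult using low by (rule mult_right_mono) simp
    also have "\<dots> \<le> b * y" using rhs[OF zL] eq[of z] by simp
    finally show ?thesis using y0 gap(1) by (simp add: field_simps power2_eq_square)
  qed
  \<comment> \<open>\<open>h z\<close> collects the terms of the equation at \<open>z\<close> that
    stay bounded: the factor \<open>\<mu> - r * y^2\<close> of order \<open>y\<close> is compensated
    by \<open>f z\<close> of order \<open>1 / y\<close>.\<close>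
  define h where "h z = FF z - e z - (\<mu> - of_real (r * y\<^sup>2)) * f z" for z
  have h: "cmod (h z) \<le> b + 2 * b\<^sup>2 / g" if z: "z \<in> L - L'" for z
  proof -
    have "cmod (h z) \<le> cmod (FF z) + cmod (e z) + cmod (\<mu> - of_real (r * y\<^sup>2)) * cmod (f z)"
      unfolding h_def norm_mult[symmetric] by (meson norm_triangle_ineq4 order_trans add_right_mono)
    also have "\<dots> \<le> B + 1 + b * y * (2 * b / g / y)"
      using FFb[of z] e[of z] \<delta> mu off[OF z] z b y0 by (intro add_mono mult_mono) auto
    also have "b * y * (2 * b / g / y) = 2 * b\<^sup>2 / g" using y0 by (simp add: power2_eq_square)
    also have "B + 1 + 2 * b\<^sup>2 / g \<le> b + 2 * b\<^sup>2 / g" using B(1) by (simp add: b_def)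
    finally show ?thesis .
  qed
  have fz: "of_real y * f z = EE z / of_real (r - d z) + h z / of_real ((r - d z) * y)" if z: "z \<in> L - L'" for z
  proof -
    have nz: "of_real (r - d z) \<noteq> (0::complex)" "of_real y \<noteq> (0::complex)" using z y0 by (auto simp: L'_def)
    have "of_real (r - d z) * (of_real y * (of_real y * f z)) = of_real y * EE z + h z"
      using eq[of z] by (simp add: h_def algebra_simps power2_eq_square)
    moreover have "Y * x = a / q + c / (q * Y)" if "q \<noteq> 0" "Y \<noteq> 0" "q * (Y * (Y * x)) = Y * a + c"
      for q Y x a c :: complex
      using that by (simp add: field_simps)
    ultimately show ?thesis using nz unfolding of_real_mult by blast
  qed
  fix u assume u: "u \<in> L'"
  then have uL: "u \<in> L" and ur: "d u = r" by (auto simp: L'_def)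
  have sub: "L' \<subseteq> L" by (auto simp: L'_def)
  have splitL: "(\<Sum>w\<in>L. G w) = (\<Sum>w\<in>L'. G w) + (\<Sum>w\<in>L - L'. G w)" for G :: "'a \<Rightarrow> complex"
    using sum.subset_diff[OF sub L, of G] by (simp add: add.commute)
  have part: "(\<Sum>w\<in>L - L'. \<bar>G w\<bar>) \<le> (\<Sum>w\<in>L. \<bar>G w\<bar>)" for G :: "'a \<Rightarrow> real"
    by (rule sum_mono2) (use L in auto)
  define p where "p = 2 * b / g / y"
  have p0: "p \<ge> 0" using b gap(1) y0 by (simp add: p_def)
  define EN where "EN z = (\<Sum>w\<in>L'. of_real (E z w) * f w)" for z
  define EF where "EF z = (\<Sum>w\<in>L - L'. of_real (E z w) * f w)" for z
  define FFF where "FFF = (\<Sum>w\<in>L - L'. of_real (F u w) * f w)"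
  have EF: "cmod (EF z) \<le> B * p" if "z \<in> L" for z
    unfolding EF_def by (rule cmod_sum_mult_le) (use off p0 part[of "E z"] B(2)[OF that] in \<open>auto simp: p_def\<close>)
  have FFF: "cmod FFF \<le> B * p"
    unfolding FFF_def by (rule cmod_sum_mult_le) (use off p0 part[of "F u"] B(3)[OF uL] in \<open>auto simp: p_def\<close>)
  \<comment> \<open>By \<open>E0\<close> the level is not coupled to itself at order
    \<open>y\<close>, so only the small values of \<open>f\<close> off the level enter.\<close>
  have "EE u = (\<Sum>z\<in>L - L'. of_real (E u z) * f z)"
    unfolding EE_def splitL using E0[OF uL _ ur] by (simp add: L'_def)
  then have "of_real y * EE u = (\<Sum>z\<in>L - L'. of_real (E u z) * (of_real y * f z))"
    by (simp add: sum_distrib_left mult.left_commute)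
  \<comment> \<open>The part \<open>EN\<close> with values on the level gives the effective matrix;
    the parts with \<open>EF\<close> and \<open>h\<close> are errors of order
    \<open>1 / y\<close>.\<close>
  also have "\<dots> = (\<Sum>z\<in>L - L'. of_real (E u z) * (EN z / of_real (r - d z)))
       + (\<Sum>z\<in>L - L'. of_real (E u z) * (EF z / of_real (r - d z)))
       + (\<Sum>z\<in>L - L'. of_real (E u z) * (h z / of_real ((r - d z) * y)))"
  proof -
    have "of_real (E u z) * (of_real y * f z) = of_real (E u z) * (EN z / of_real (r - d z))
       + of_real (E u z) * (EF z / of_real (r - d z)) + of_real (E u z) * (h z / of_real ((r - d z) * y))"
      if "z \<in> L - L'" for z
      unfolding fz[OF that] by (simp add: EE_def splitL EN_def EF_def algebra_simps add_divide_distrib)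
    then show ?thesis by (simp add: sum.distrib)
  qed
  finally have yE: "of_real y * EE u = \<dots>" .
  have main: "(\<Sum>z\<in>L - L'. of_real (E u z) * (EN z / of_real (r - d z)))
      = (\<Sum>w\<in>L'. of_real (\<Sum>z\<in>L - L'. E u z * E z w / (r - d z)) * f w)"
  proof -
    have "(\<Sum>z\<in>L - L'. of_real (E u z) * (EN z / of_real (r - d z)))
       = (\<Sum>z\<in>L - L'. \<Sum>w\<in>L'. of_real (E u z * E z w / (r - d z)) * f w)"
      by (simp add: EN_def sum_distrib_left sum_divide_distrib mult_ac)
    also have "\<dots> = (\<Sum>w\<in>L'. \<Sum>z\<in>L - L'. of_real (E u z * E z w / (r - d z)) * f w)" by (rule sum.swap)
    also have "\<dots> = (\<Sum>w\<in>L'. of_real (\<Sum>z\<in>L - L'. E u z * E z w / (r - d z)) * f w)"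
      by (simp add: sum_distrib_right)
    finally show ?thesis .
  qed
  have err1: "cmod (\<Sum>z\<in>L - L'. of_real (E u z) * (EF z / of_real (r - d z))) \<le> B * (B * p / g)"
  proof (rule cmod_sum_mult_le)
    fix z assume z: "z \<in> L - L'"
    then have "\<bar>r - d z\<bar> \<ge> g" using gap(2) by (auto simp: L'_def)
    then show "cmod (EF z / of_real (r - d z)) \<le> B * p / g"
      unfolding norm_divide norm_of_real using EF[of z] z gap(1) B(1) p0 by (intro frac_le) auto
  qed (use part[of "E u"] B(2)[OF uL] B(1) p0 gap(1) in auto)
  have err2: "cmod (\<Sum>z\<in>L - L'. of_real (E u z) * (h z / of_real ((r - d z) * y))) \<le> B * ((b + 2 * b\<^sup>2 / g) / (g * y))"
  proof (rule cmod_sum_mult_le)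
    fix z assume z: "z \<in> L - L'"
    then have "\<bar>r - d z\<bar> \<ge> g" using gap(2) by (auto simp: L'_def)
    then show "cmod (h z / of_real ((r - d z) * y)) \<le> (b + 2 * b\<^sup>2 / g) / (g * y)"
      unfolding norm_divide norm_of_real abs_mult using h[OF z] gap(1) b y0 by (intro frac_le mult_mono) auto
  qed (use part[of "E u"] B(2)[OF uL] b y0 gap(1) in auto)
  have "(\<Sum>w\<in>L'. of_real (F u w + (\<Sum>z\<in>L - L'. E u z * E z w / (r - d z))) * f w)
      = (\<Sum>w\<in>L'. of_real (F u w) * f w) + (\<Sum>w\<in>L'. of_real (\<Sum>z\<in>L - L'. E u z * E z w / (r - d z)) * f w)"
    by (simp add: algebra_simps sum.distrib)
  moreover have "(\<Sum>w\<in>L'. of_real (F u w) * f w) = FF u - FFF"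
    by (simp add: FF_def FFF_def splitL)
  ultimately have eq2: "(\<Sum>w\<in>L'. of_real (F u w + (\<Sum>z\<in>L - L'. E u z * E z w / (r - d z))) * f w)
            - (\<mu> - of_real (r * y\<^sup>2)) * f u
      = e u - FFF - (\<Sum>z\<in>L - L'. of_real (E u z) * (EF z / of_real (r - d z)))
        - (\<Sum>z\<in>L - L'. of_real (E u z) * (h z / of_real ((r - d z) * y)))"
    using eq[of u] yE main ur by (simp add: algebra_simps)
  have "cmod (e u - FFF - (\<Sum>z\<in>L - L'. of_real (E u z) * (EF z / of_real (r - d z)))
        - (\<Sum>z\<in>L - L'. of_real (E u z) * (h z / of_real ((r - d z) * y))))
     \<le> \<delta> + B * p + B * (B * p / g) + B * ((b + 2 * b\<^sup>2 / g) / (g * y))"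
    by (intro order_trans[OF norm_triangle_ineq4] add_mono e[OF uL] FFF err1 err2)
  also have "\<dots> = \<delta> + C / y"
    using y0 gap(1) by (simp add: C_def p_def field_simps)
  finally show "cmod ((\<Sum>w\<in>L'. of_real (F u w + (\<Sum>z\<in>L - L'. E u z * E z w / (r - d z))) * f w)
            - (\<mu> - of_real (r * y\<^sup>2)) * f u) \<le> \<delta> + C / y"
    using eq2 by simp
qed

section \<open>Two-adic invariants of the elimination\<close>

text \<open>\<open>loc_mult k r\<close> says that \<open>r\<close> lies in \<open>k\<close> times the localization of the integers at 2.\<close>

definition loc_mult :: "int \<Rightarrow> real \<Rightarrow> bool" where
  "loc_mult k r \<longleftrightarrow> (\<exists>q n. odd q \<and> of_int q * r = of_int (k * n))"

lemma loc_mult_int: "loc_mult k (of_int (k * n))"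
  unfolding loc_mult_def by (rule exI[of _ 1]) auto

lemma loc_mult_0: "loc_mult k 0"
  using loc_mult_int[of k 0] by simp

lemma loc_mult_add:
  assumes "loc_mult k r" "loc_mult k s"
  shows "loc_mult k (r + s)"
proof -
  obtain p m q n where "odd p" "of_int p * r = of_int (k * m)" "odd q" "of_int q * s = of_int (k * n)"
    using assms by (auto simp: loc_mult_def)
  then have "odd (p * q)" "of_int (p * q) * (r + s) = of_int (k * (q * m + p * n))"
    by (auto simp: algebra_simps)
  then show ?thesis unfolding loc_mult_def by blast
qed

lemma loc_mult_mult:
  assumes "loc_mult k r" "loc_mult l s"
  shows "loc_mult (k * l) (r * s)"
proof -
  obtain p m q n where "odd p" "of_int p * r = of_int (k * m)" "odd q" "of_int q * s = of_int (l * n)"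
    using assms by (auto simp: loc_mult_def)
  then have "odd (p * q)" "of_int (p * q) * (r * s) = of_int ((k * l) * (m * n))"
    by (auto simp: algebra_simps)
  then show ?thesis unfolding loc_mult_def by blast
qed

lemma loc_mult_minus: "loc_mult k r \<Longrightarrow> loc_mult k (- r)"
  using loc_mult_mult[of k r 1 "-1"] loc_mult_int[of 1 "-1"] by simp

lemma loc_mult_sum: "(\<And>z. z \<in> Z \<Longrightarrow> loc_mult k (h z)) \<Longrightarrow> loc_mult k (\<Sum>z\<in>Z. h z)"
  by (induction Z rule: infinite_finite_induct) (auto intro: loc_mult_add loc_mult_0)

lemma loc_mult_of_int_dvd:
  assumes "loc_mult 4 (of_int n)" shows "4 dvd n"
proof -
  obtain q m where q: "odd q" "of_int q * (of_int n :: real) = of_int (4 * m)"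
    using assms by (auto simp: loc_mult_def)
  then have "q * n = 4 * m" by (metis of_int_eq_iff of_int_mult)
  then have "4 dvd q * n" by simp
  moreover have "coprime 4 q" using q(1) coprime_power_left_iff[of 2 2 q] by simp
  ultimately show ?thesis using coprime_dvd_mult_right_iff by blast
qed

text \<open>A number congruent to an odd integer modulo 4 is a quotient of two odd integers, that
  is, a unit of the localization.\<close>

lemma loc_mult_inverse:
  assumes "loc_mult 4 (r - of_int n)" "odd n"
  shows "loc_mult 1 (1 / r)"
proof -
  obtain q m where q: "odd q" "of_int q * (r - of_int n) = of_int (4 * m)"
    using assms by (auto simp: loc_mult_def)
  define p where "p = 4 * m + q * n"
  have p: "odd p" "of_int q * r = of_int p" using q assms(2) by (auto simp: p_def algebra_simps)
  then have "of_int p * (1 / r) = of_int (1 * q)" by (cases "r = 0") (auto simp: field_simps)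
  then show ?thesis using p unfolding loc_mult_def by blast
qed

text \<open>The signs of both unit steps are left free, so that one symmetric relation on labels
  covers black and red edges alike.\<close>

definition nbr :: "'m \<Rightarrow> 'm \<Rightarrow> int ^ ('m::finite) \<Rightarrow> int ^ 'm \<Rightarrow> bool" where
  "nbr i j a b \<longleftrightarrow> i \<noteq> j \<and> \<bar>b $ i - a $ i\<bar> = 1 \<and> \<bar>b $ j - a $ j\<bar> = 1 \<and> (\<forall>l. l \<noteq> i \<longrightarrow> l \<noteq> j \<longrightarrow> b $ l = a $ l)"

type_synonym 'm coef = "int ^ 'm \<Rightarrow> int ^ 'm \<Rightarrow> 'm \<Rightarrow> 'm \<Rightarrow> real"

text \<open>The matrices below have entries \<open>\<Sum> A a b i j * y\<^sub>i * y\<^sub>j\<close> with \<open>y\<^sub>i = sqrt \<xi>\<^sub>i\<close>. Predicate \<open>good\<close>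
  is the invariant of the elimination: up to multiples of 4 the coefficient of \<open>\<xi>\<^sub>i\<close> at \<open>a\<close> is
  \<open>- a $ i\<close>, and off-diagonal coefficients are even.\<close>

definition good :: "'m set \<Rightarrow> (int ^ ('m::finite)) set \<Rightarrow> 'm coef \<Rightarrow> bool" where
  "good R L A \<longleftrightarrow> finite L
    \<and> (\<forall>a\<in>L. \<forall>b\<in>L. \<forall>i\<in>R. \<bar>b $ i - a $ i\<bar> = 2 \<longrightarrow> (\<exists>l. l \<noteq> i \<and> b $ l \<noteq> a $ l))
    \<and> (\<forall>a\<in>L. \<forall>b\<in>L. \<forall>i\<in>R. \<forall>j\<in>R. A a b i j \<noteq> 0 \<longrightarrow> a = b \<and> i = j \<or> nbr i j a b)
    \<and> (\<forall>a\<in>L. \<forall>i\<in>R. loc_mult 4 (A a a i i + of_int (a $ i)))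
    \<and> (\<forall>a\<in>L. \<forall>b\<in>L. \<forall>i\<in>R. \<forall>j\<in>R. i \<noteq> j \<longrightarrow> loc_mult 2 (A a b i j + A a b j i))"

lemma goodD:
  assumes "good R L A"
  shows good_finite: "finite L"
    and good_diff: "\<lbrakk>a \<in> L; b \<in> L; i \<in> R; \<bar>b $ i - a $ i\<bar> = 2\<rbrakk> \<Longrightarrow> \<exists>l. l \<noteq> i \<and> b $ l \<noteq> a $ l"
    and good_support: "\<lbrakk>a \<in> L; b \<in> L; i \<in> R; j \<in> R; A a b i j \<noteq> 0\<rbrakk> \<Longrightarrow> a = b \<and> i = j \<or> nbr i j a b"
    and good_diag: "\<lbrakk>a \<in> L; i \<in> R\<rbrakk> \<Longrightarrow> loc_mult 4 (A a a i i + of_int (a $ i))"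
    and good_even: "\<lbrakk>a \<in> L; b \<in> L; i \<in> R; j \<in> R; i \<noteq> j\<rbrakk> \<Longrightarrow> loc_mult 2 (A a b i j + A a b j i)"
  using assms unfolding good_def by simp_all

definition level :: "'m \<Rightarrow> real \<Rightarrow> (int ^ ('m::finite)) set \<Rightarrow> 'm coef \<Rightarrow> (int ^ 'm) set" where
  "level k r L A = {a \<in> L. A a a k k = r}"

text \<open>For \<open>i\<close> different from \<open>k\<close> this is the full coefficient of
  \<open>y i * y k\<close> in a matrix entry, where both orders of the pair contribute.\<close>

definition cross :: "'m \<Rightarrow> ('m::finite) coef \<Rightarrow> int ^ 'm \<Rightarrow> int ^ 'm \<Rightarrow> 'm \<Rightarrow> real" where
  "cross k A a b i = A a b i k + A a b k i"

text \<open>Second-order perturbation theory: for \<open>\<xi>\<^sub>k\<close> large, the couplings of order \<open>y\<^sub>k\<close> between the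
  eigenvalue \<open>r * \<xi>\<^sub>k\<close> and the others leave a correction of order 1 at that eigenvalue.\<close>

definition schur :: "'m \<Rightarrow> real \<Rightarrow> (int ^ ('m::finite)) set \<Rightarrow> 'm coef \<Rightarrow> 'm coef" where
  "schur k r L A a b i j = A a b i j
     + (\<Sum>z\<in>L - level k r L A. cross k A a z i * cross k A z b j / (r - A z z k k))"

lemma good_cross_nbr:
  assumes "good R L A" "a \<in> L" "b \<in> L" "k \<in> R" "i \<in> R - {k}" "cross k A a b i \<noteq> 0"
  shows "nbr i k a b"
proof -
  have "A a b i k \<noteq> 0 \<or> A a b k i \<noteq> 0" using assms(6) by (auto simp: cross_def)
  then have "nbr i k a b \<or> nbr k i a b" using good_support[OF assms(1)] assms by blast
  then show ?thesis by (auto simp: nbr_def)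
qed

text \<open>The diagonal coefficient of \<open>\<xi> k\<close> remembers \<open>- a $ k\<close>
  modulo 4, so equal coefficients force congruent coordinates.\<close>

lemma level_dvd:
  assumes "good R L A" "k \<in> R" "a \<in> level k r L A" "b \<in> level k r L A"
  shows "4 dvd b $ k - a $ k"
proof -
  have "loc_mult 4 (A a a k k + of_int (a $ k))" "loc_mult 4 (A b b k k + of_int (b $ k))"
    using good_diag[OF assms(1)] assms unfolding level_def by blast+
  from loc_mult_add[OF this(2) loc_mult_minus[OF this(1)]]
  have "loc_mult 4 (of_int (b $ k - a $ k))" using assms by (simp add: level_def)
  then show ?thesis by (rule loc_mult_of_int_dvd)
qed

text \<open>A coupling through \<open>k\<close> changes coordinate \<open>k\<close> by one, which is
  incompatible with congruence modulo 4. This supplies the hypothesis \<open>E0\<close> of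
  \<open>schur_step\<close>.\<close>

lemma level_cross:
  assumes "good R L A" "k \<in> R" "i \<in> R - {k}" "a \<in> level k r L A" "b \<in> level k r L A"
  shows "cross k A a b i = 0"
proof (rule ccontr)
  assume "cross k A a b i \<noteq> 0"
  then have "nbr i k a b" using good_cross_nbr[OF assms(1)] assms by (auto simp: level_def)
  then have "\<bar>b $ k - a $ k\<bar> = 1" by (simp add: nbr_def)
  moreover have "4 dvd b $ k - a $ k" using level_dvd assms by blast
  ultimately show False by presburger
qed

text \<open>A correction term runs from \<open>a\<close> through \<open>z\<close> to
  \<open>b\<close> by two steps that each change coordinate \<open>k\<close> by one. As
  \<open>a\<close> and \<open>b\<close> lie on one level, the two changes cancel, and what remains
  is a step in \<open>i\<close> and \<open>j\<close> or no step at all.\<close>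

lemma good_schur:
  assumes g: "good R L A" and k: "k \<in> R"
  shows "good (R - {k}) (level k r L A) (schur k r L A)"
proof -
  let ?L = "level k r L A"
  have sub: "?L \<subseteq> L" by (auto simp: level_def)
  have path: "a = b \<and> i = j \<or> nbr i j a b"
    if ab: "a \<in> ?L" "b \<in> ?L" "z \<in> L" and ij: "i \<in> R - {k}" "j \<in> R - {k}"
      and nz: "cross k A a z i \<noteq> 0" "cross k A z b j \<noteq> 0" for a b z i j
  proof -
    have n1: "nbr i k a z" using good_cross_nbr[OF g _ ab(3) k ij(1) nz(1)] ab(1) sub by blast
    have n2: "nbr j k z b" using good_cross_nbr[OF g ab(3) _ k ij(2) nz(2)] ab(2) sub by blast
    have d4: "4 dvd b $ k - a $ k" using level_dvd[OF g k] ab by blast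
    have "\<bar>z $ k - a $ k\<bar> = 1" "\<bar>b $ k - z $ k\<bar> = 1" using n1 n2 by (auto simp: nbr_def)
    then have bk: "b $ k = a $ k" using d4 by presburger
    show ?thesis
    proof (cases "i = j")
      case False
      have "b $ l = a $ l" if "l \<noteq> i" "l \<noteq> j" for l using n1 n2 bk that by (cases "l = k") (auto simp: nbr_def)
      moreover have "z $ j = a $ j" "b $ i = z $ i" using n1 n2 ij False by (auto simp: nbr_def)
      ultimately have "nbr i j a b" using n1 n2 False by (simp add: nbr_def)
      then show ?thesis ..
    next
      case True
      \<comment> \<open>Two steps along the same \<open>i\<close> either cancel or add up to a
        change by 2 in that coordinate alone; the latter is what the second clause of
        \<open>good\<close> excludes.\<close>
      have oth: "b $ l = a $ l" if "l \<noteq> i" for l using n1 n2 bk that True by (cases "l = k") (auto simp: nbr_def)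
      have "\<bar>z $ i - a $ i\<bar> = 1" "\<bar>b $ i - z $ i\<bar> = 1" using n1 n2 True by (auto simp: nbr_def)
      then have "\<bar>b $ i - a $ i\<bar> = 2 \<or> b $ i = a $ i" by presburger
      moreover have "\<bar>b $ i - a $ i\<bar> \<noteq> 2"
        using good_diff[OF g, of a b i] ab ij oth sub by blast
      ultimately have "b = a" using oth by (metis vec_eq_iff)
      then show ?thesis using True by simp
    qed
  qed
  \<comment> \<open>The denominator is congruent to the odd number \<open>z $ k - a $ k\<close>
    modulo 4, hence a unit, and each of the two cross coefficients is even.\<close>
  have unit: "loc_mult 4 (cross k A a z i * cross k A z b j / (r - A z z k k))"
    if ab: "a \<in> ?L" "b \<in> ?L" "z \<in> L - ?L" and ij: "i \<in> R - {k}" "j \<in> R - {k}" for a b z i j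
  proof (cases "cross k A a z i = 0")
    case False
    then have n1: "nbr i k a z" using good_cross_nbr[OF g] ab ij k sub by blast
    have "loc_mult 4 (A a a k k + of_int (a $ k))" "loc_mult 4 (A z z k k + of_int (z $ k))"
      using good_diag[OF g] ab k sub by blast+
    from loc_mult_add[OF this(1) loc_mult_minus[OF this(2)]]
    have "loc_mult 4 (r - A z z k k - of_int (z $ k - a $ k))" using ab by (simp add: level_def algebra_simps)
    moreover have "\<bar>z $ k - a $ k\<bar> = 1" using n1 by (simp add: nbr_def)
    then have "odd (z $ k - a $ k)" by presburger
    ultimately have "loc_mult 1 (1 / (r - A z z k k))" by (blast intro: loc_mult_inverse)
    moreover have "loc_mult 2 (cross k A a z i)" "loc_mult 2 (cross k A z b j)"
      unfolding cross_def using good_even[OF g] ab ij k sub by blast+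
    ultimately show ?thesis
      using loc_mult_mult[OF loc_mult_mult[of 2 "cross k A a z i" 2 "cross k A z b j"], of 1 "1 / (r - A z z k k)"]
      by simp
  qed (simp add: loc_mult_0)
  have two: "loc_mult 2 x" if "loc_mult 4 x" for x
  proof -
    obtain q n where "odd q" "of_int q * x = of_int (2 * (2 * n))" using \<open>loc_mult 4 x\<close> by (auto simp: loc_mult_def)
    then show ?thesis unfolding loc_mult_def by blast
  qed
  show ?thesis
    unfolding good_def
  proof (intro conjI ballI impI)
    show "finite ?L" using good_finite[OF g] sub by (rule rev_finite_subset)
  next
    fix a b i assume "a \<in> ?L" "b \<in> ?L" "i \<in> R - {k}" "\<bar>b $ i - a $ i\<bar> = 2"
    then show "\<exists>l. l \<noteq> i \<and> b $ l \<noteq> a $ l" using good_diff[OF g, of a b i] sub by blast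
  next
    fix a b i j assume ab: "a \<in> ?L" "b \<in> ?L" "i \<in> R - {k}" "j \<in> R - {k}" and nz: "schur k r L A a b i j \<noteq> 0"
    show "a = b \<and> i = j \<or> nbr i j a b"
    proof (cases "A a b i j = 0")
      case False
      then show ?thesis using good_support[OF g] ab sub by blast
    next
      case True
      then have "(\<Sum>z\<in>L - ?L. cross k A a z i * cross k A z b j / (r - A z z k k)) \<noteq> 0"
        using nz by (simp add: schur_def)
      then obtain z where "z \<in> L - ?L" "cross k A a z i * cross k A z b j / (r - A z z k k) \<noteq> 0"
        by (rule sum.not_neutral_contains_not_neutral)
      then show ?thesis using path[of a b z i j] ab by auto
    qed
  next
    fix a i assume a: "a \<in> ?L" "i \<in> R - {k}"
    then have "loc_mult 4 (A a a i i + of_int (a $ i))" using good_diag[OF g] sub by blast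
    moreover have "loc_mult 4 (\<Sum>z\<in>L - ?L. cross k A a z i * cross k A z a i / (r - A z z k k))"
      by (rule loc_mult_sum) (use unit a in blast)
    ultimately have "loc_mult 4 (A a a i i + of_int (a $ i)
        + (\<Sum>z\<in>L - ?L. cross k A a z i * cross k A z a i / (r - A z z k k)))"
      by (rule loc_mult_add)
    then show "loc_mult 4 (schur k r L A a a i i + of_int (a $ i))"
      by (simp only: schur_def add.assoc add.commute add.left_commute)
  next
    fix a b i j assume ab: "a \<in> ?L" "b \<in> ?L" "i \<in> R - {k}" "j \<in> R - {k}" "i \<noteq> j"
    then have "loc_mult 2 (A a b i j + A a b j i)" using good_even[OF g] sub by blast
    moreover have "loc_mult 2 (\<Sum>z\<in>L - ?L. cross k A a z i * cross k A z b j / (r - A z z k k))"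
      by (rule loc_mult_sum) (use two unit ab in blast)
    moreover have "loc_mult 2 (\<Sum>z\<in>L - ?L. cross k A a z j * cross k A z b i / (r - A z z k k))"
      by (rule loc_mult_sum) (use two unit ab in blast)
    ultimately have "loc_mult 2 (A a b i j + A a b j i
        + (\<Sum>z\<in>L - ?L. cross k A a z i * cross k A z b j / (r - A z z k k))
        + (\<Sum>z\<in>L - ?L. cross k A a z j * cross k A z b i / (r - A z z k k)))"
      by (rule loc_mult_add[OF loc_mult_add])
    then show "loc_mult 2 (schur k r L A a b i j + schur k r L A a b j i)"
      by (simp only: schur_def add.assoc add.commute add.left_commute)
  qed
qed

section \<open>Hierarchical parameters\<close>

definition sysmat :: "'m set \<Rightarrow> ('m \<Rightarrow> real) \<Rightarrow> ('m::finite) coef \<Rightarrow> int ^ 'm \<Rightarrow> int ^ 'm \<Rightarrow> real" where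
  "sysmat R y A a b = (\<Sum>i\<in>R. \<Sum>j\<in>R. A a b i j * y i * y j)"

definition approx_eig ::
  "'m set \<Rightarrow> ('m \<Rightarrow> real) \<Rightarrow> (int ^ ('m::finite)) set \<Rightarrow> 'm coef \<Rightarrow> (int ^ 'm \<Rightarrow> complex) \<Rightarrow> complex \<Rightarrow> real \<Rightarrow> bool"
  where "approx_eig R y L A f \<mu> \<delta> \<longleftrightarrow>
    (\<forall>u\<in>L. cmod ((\<Sum>w\<in>L. of_real (sysmat R y A u w) * f w) - \<mu> * f u) \<le> \<delta>)"

lemma sysmat_insert:
  assumes "k \<notin> R"
  shows "sysmat (insert k R) y A a b
    = A a b k k * (y k)\<^sup>2 + y k * (\<Sum>i\<in>R. cross k A a b i * y i) + sysmat R y A a b"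
proof -
  have "(\<Sum>i\<in>R. cross k A a b i * y i) = (\<Sum>i\<in>R. A a b i k * y i) + (\<Sum>i\<in>R. A a b k i * y i)"
    by (simp add: cross_def algebra_simps sum.distrib)
  then show ?thesis
    using assms
    by (simp add: sysmat_def sum.distrib sum_distrib_left algebra_simps power2_eq_square)
qed

text \<open>This identifies the effective matrix of \<open>schur_step\<close> as a
  \<open>sysmat\<close> with coefficients \<open>schur\<close>, so that the elimination can be
  iterated.\<close>

lemma sysmat_schur:
  "sysmat R y (schur k r L A) a b = sysmat R y A a b
     + (\<Sum>z\<in>L - level k r L A. (\<Sum>i\<in>R. cross k A a z i * y i) * (\<Sum>j\<in>R. cross k A z b j * y j) / (r - A z z k k))"
proof -
  let ?Z = "L - level k r L A"
  have "(\<Sum>i\<in>R. \<Sum>j\<in>R. (\<Sum>z\<in>?Z. cross k A a z i * cross k A z b j / (r - A z z k k)) * y i * y j)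
      = (\<Sum>i\<in>R. \<Sum>j\<in>R. \<Sum>z\<in>?Z. (cross k A a z i * y i) * (cross k A z b j * y j) / (r - A z z k k))"
    unfolding sum_distrib_right by (intro sum.cong refl) (simp add: mult_ac)
  also have "\<dots> = (\<Sum>i\<in>R. \<Sum>z\<in>?Z. \<Sum>j\<in>R. (cross k A a z i * y i) * (cross k A z b j * y j) / (r - A z z k k))"
    by (intro sum.cong refl sum.swap)
  also have "\<dots> = (\<Sum>z\<in>?Z. \<Sum>i\<in>R. \<Sum>j\<in>R. (cross k A a z i * y i) * (cross k A z b j * y j) / (r - A z z k k))"
    by (rule sum.swap)
  also have "\<dots> = (\<Sum>z\<in>?Z. (\<Sum>i\<in>R. cross k A a z i * y i) * (\<Sum>j\<in>R. cross k A z b j * y j) / (r - A z z k k))"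
    by (simp add: sum_product sum_divide_distrib)
  finally show ?thesis
    by (simp add: sysmat_def schur_def algebra_simps sum.distrib)
qed

text \<open>The right-hand sides depend on \<open>y\<close> only through \<open>Y\<close>, and
  summing over all rows makes them independent of \<open>u\<close>.\<close>

lemma sysmat_bound:
  assumes "finite R" "finite L" "u \<in> L" "\<And>i. i \<in> R \<Longrightarrow> 0 \<le> y i \<and> y i \<le> Y"
  shows "(\<Sum>w\<in>L. \<bar>sysmat R y A u w\<bar>) \<le> (\<Sum>u\<in>L. \<Sum>w\<in>L. \<Sum>i\<in>R. \<Sum>j\<in>R. \<bar>A u w i j\<bar> * Y * Y)"
    and "(\<Sum>w\<in>L. \<bar>\<Sum>i\<in>R. cross k A u w i * y i\<bar>) \<le> (\<Sum>u\<in>L. \<Sum>w\<in>L. \<Sum>i\<in>R. \<bar>cross k A u w i\<bar> * Y)"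
proof -
  have nn: "0 \<le> \<bar>A u w i j\<bar> * Y * Y" "0 \<le> \<bar>cross k A u w i\<bar> * Y" if "i \<in> R" for u w i j
    using assms(4)[OF that] by (auto intro!: mult_nonneg_nonneg)
  have "(\<Sum>w\<in>L. \<bar>sysmat R y A u w\<bar>) \<le> (\<Sum>w\<in>L. \<Sum>i\<in>R. \<Sum>j\<in>R. \<bar>A u w i j\<bar> * Y * Y)"
    unfolding sysmat_def
    by (intro sum_mono order_trans[OF sum_abs])
      (use assms(4) in \<open>fastforce simp: abs_mult intro!: mult_mono mult_nonneg_nonneg intro: order_trans\<close>)
  also have "\<dots> \<le> (\<Sum>u\<in>L. \<Sum>w\<in>L. \<Sum>i\<in>R. \<Sum>j\<in>R. \<bar>A u w i j\<bar> * Y * Y)"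
    by (rule member_le_sum[OF assms(3) _ assms(2)]) (intro sum_nonneg nn)
  finally show "(\<Sum>w\<in>L. \<bar>sysmat R y A u w\<bar>) \<le> (\<Sum>u\<in>L. \<Sum>w\<in>L. \<Sum>i\<in>R. \<Sum>j\<in>R. \<bar>A u w i j\<bar> * Y * Y)" .
  have "(\<Sum>w\<in>L. \<bar>\<Sum>i\<in>R. cross k A u w i * y i\<bar>) \<le> (\<Sum>w\<in>L. \<Sum>i\<in>R. \<bar>cross k A u w i\<bar> * Y)"
    by (intro sum_mono order_trans[OF sum_abs])
      (use assms(4) in \<open>fastforce simp: abs_mult intro!: mult_mono mult_nonneg_nonneg intro: order_trans\<close>)
  also have "\<dots> \<le> (\<Sum>u\<in>L. \<Sum>w\<in>L. \<Sum>i\<in>R. \<bar>cross k A u w i\<bar> * Y)"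
    by (rule member_le_sum[OF assms(3) _ assms(2)]) (intro sum_nonneg nn)
  finally show "(\<Sum>w\<in>L. \<bar>\<Sum>i\<in>R. cross k A u w i * y i\<bar>) \<le> (\<Sum>u\<in>L. \<Sum>w\<in>L. \<Sum>i\<in>R. \<bar>cross k A u w i\<bar> * Y)" .
qed

lemma finite_gap:
  fixes d :: "'a \<Rightarrow> real"
  assumes "finite L"
  obtains g where "g > 0" "\<And>u z. u \<in> L \<Longrightarrow> z \<in> L \<Longrightarrow> d z \<noteq> d u \<Longrightarrow> \<bar>d u - d z\<bar> \<ge> g"
proof -
  \<comment> \<open>The element 1 keeps the set nonempty when \<open>d\<close> is constant on
    \<open>L\<close>.\<close>
  let ?S = "insert 1 ((\<lambda>(u, z). \<bar>d u - d z\<bar>) ` {(u, z) \<in> L \<times> L. d z \<noteq> d u})"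
  have fin: "finite ?S" using assms by (auto intro: finite_subset[of _ "L \<times> L"])
  show ?thesis
  proof (rule that[of "Min ?S"])
    show "Min ?S > 0" using fin by (subst Min_gr_iff) auto
    show "\<bar>d u - d z\<bar> \<ge> Min ?S" if "u \<in> L" "z \<in> L" "d z \<noteq> d u" for u z
      by (rule Min_le[OF fin]) (use that in auto)
  qed
qed

text \<open>The order of quantifiers matters: \<open>T\<close> is fixed before \<open>\<xi>\<close>,
  \<open>f\<close>, \<open>\<mu>\<close> and \<open>u0\<close>, and uses only the upper bounds
  \<open>h\<close> for the smaller parameters. Half of the tolerance \<open>\<delta>\<close> is
  reserved for the error \<open>C / y\<close> of \<open>schur_step\<close>.\<close>

lemma schur_threshold:
  assumes g: "good (insert k R) L A" and k: "k \<notin> R"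
    and pos: "\<theta> > 0" "\<delta> > 0" "\<delta> \<le> 1"
  shows "\<exists>T\<ge>0. \<forall>\<xi> f \<mu> u0. (\<forall>i\<in>R. 0 < \<xi> i \<and> \<xi> i < h i) \<longrightarrow> \<xi> k > T \<longrightarrow> (\<forall>u\<in>L. cmod (f u) \<le> 1) \<longrightarrow>
     u0 \<in> L \<longrightarrow> cmod (f u0) = 1 \<longrightarrow> approx_eig (insert k R) (sqrt \<circ> \<xi>) L A f \<mu> (\<delta> / 2) \<longrightarrow>
     approx_eig R (sqrt \<circ> \<xi>) (level k (A u0 u0 k k) L A) (schur k (A u0 u0 k k) L A) f
        (\<mu> - of_real (A u0 u0 k k * \<xi> k)) \<delta>
     \<and> (\<forall>z\<in>L - level k (A u0 u0 k k) L A. cmod (f z) \<le> \<theta>)"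
proof -
  have finL: "finite L" by (rule good_finite[OF g])
  have finR: "finite R" by simp
  obtain gp where gp: "gp > 0" "\<And>u z. u \<in> L \<Longrightarrow> z \<in> L \<Longrightarrow> A z z k k \<noteq> A u u k k \<Longrightarrow> \<bar>A u u k k - A z z k k\<bar> \<ge> gp"
    using finite_gap[OF finL, of "\<lambda>u. A u u k k"] by blast
  \<comment> \<open>A common bound for all \<open>sqrt (\<xi> i)\<close> with \<open>i\<close> in
    \<open>R\<close>.\<close>
  define Y where "Y = (\<Sum>i\<in>R. sqrt \<bar>h i\<bar>)"
  define B where "B = (\<Sum>u\<in>L. \<Sum>w\<in>L. \<Sum>i\<in>R. \<Sum>j\<in>R. \<bar>A u w i j\<bar> * Y * Y)
     + (\<Sum>u\<in>L. \<Sum>w\<in>L. \<Sum>i\<in>R. \<bar>cross k A u w i\<bar> * Y)"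
  have Y0: "Y \<ge> 0" unfolding Y_def by (intro sum_nonneg) simp
  have B1: "0 \<le> (\<Sum>u\<in>L. \<Sum>w\<in>L. \<Sum>i\<in>R. \<Sum>j\<in>R. \<bar>A u w i j\<bar> * Y * Y)"
    "0 \<le> (\<Sum>u\<in>L. \<Sum>w\<in>L. \<Sum>i\<in>R. \<bar>cross k A u w i\<bar> * Y)"
    by (intro sum_nonneg mult_nonneg_nonneg abs_ge_zero Y0)+
  then have B0: "B \<ge> 0" by (simp add: B_def)
  define b where "b = 2 * B + 1"
  define C where "C = B * ((b + 2 * b\<^sup>2 / gp) / gp) + B * (B * (2 * b / gp) / gp) + B * (2 * b / gp)"
  have b0: "b \<ge> 1" using B0 by (simp add: b_def)
  have C0: "C \<ge> 0" using B0 b0 gp(1) unfolding C_def by (intro add_nonneg_nonneg mult_nonneg_nonneg divide_nonneg_nonneg) auto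
  \<comment> \<open>The summands ensure in turn \<open>y >= 1\<close>, the lower bound on
    \<open>y\<close> required by \<open>schur_step\<close>, values at most \<open>\<theta>\<close>
    off the level, and an error at most \<open>\<delta> / 2\<close>. The threshold for
    \<open>\<xi> k\<close> is the square because \<open>y\<close> is its square root.\<close>
  define T where "T = 1 + 2 * b / gp + 2 * b / gp / \<theta> + 2 * C / \<delta>"
  have Tpos: "2 * b / gp \<ge> 0" "2 * b / gp / \<theta> \<ge> 0" "2 * C / \<delta> \<ge> 0"
    using b0 gp(1) pos C0 by auto
  show ?thesis
  proof (intro exI[of _ "T\<^sup>2"] conjI allI impI)
    show "0 \<le> T\<^sup>2" by simp
    fix \<xi> :: "'a \<Rightarrow> real" and f \<mu> u0
    assume \<xi>: "\<forall>i\<in>R. 0 < \<xi> i \<and> \<xi> i < h i" "\<xi> k > T\<^sup>2" and f1: "\<forall>u\<in>L. cmod (f u) \<le> 1"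
      and u0: "u0 \<in> L" "cmod (f u0) = 1"
      and ae: "approx_eig (insert k R) (sqrt \<circ> \<xi>) L A f \<mu> (\<delta> / 2)"
    define r where "r = A u0 u0 k k"
    define y where "y = sqrt (\<xi> k)"
    define E where "E = (\<lambda>u w. \<Sum>i\<in>R. cross k A u w i * (sqrt \<circ> \<xi>) i)"
    define F where "F = sysmat R (sqrt \<circ> \<xi>) A"
    have "T < y" unfolding y_def using \<xi>(2) by (simp add: real_less_rsqrt)
    then have yT: "y \<ge> 1" "y \<ge> 2 * b / gp" "y \<ge> 2 * b / gp / \<theta>" "y \<ge> 2 * C / \<delta>"
      using Tpos by (auto simp: T_def)
    have "\<xi> k \<ge> 0" using \<xi>(2) by (meson order.strict_trans1 order.strict_implies_order zero_le_power2)
    then have y2: "y\<^sup>2 = \<xi> k" by (simp add: y_def)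
    have sq: "0 \<le> (sqrt \<circ> \<xi>) i \<and> (sqrt \<circ> \<xi>) i \<le> Y" if "i \<in> R" for i
    proof -
      have "sqrt (\<xi> i) \<le> sqrt \<bar>h i\<bar>" using \<xi>(1) that by fastforce
      also have "\<dots> \<le> Y" unfolding Y_def by (rule member_le_sum[OF that]) auto
      finally show ?thesis using \<xi>(1) that by (simp add: less_imp_le)
    qed
    have EB: "(\<Sum>w\<in>L. \<bar>E u w\<bar>) \<le> B" and FB: "(\<Sum>w\<in>L. \<bar>F u w\<bar>) \<le> B" if "u \<in> L" for u
      using sysmat_bound(1)[where y = "sqrt \<circ> \<xi>" and Y = Y and A = A, OF finR finL that sq]
        sysmat_bound(2)[where y = "sqrt \<circ> \<xi>" and Y = Y and A = A and k = k, OF finR finL that sq] B1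
      by (auto simp: E_def F_def B_def)
    have E0: "E u w = 0" if "u \<in> L" "w \<in> L" "A u u k k = r" "A w w k k = r" for u w
      unfolding E_def
    proof (intro sum.neutral ballI)
      fix i assume "i \<in> R"
      then have "cross k A u w i = 0"
        by (intro level_cross[OF g, where r = r]) (use k that in \<open>auto simp: level_def\<close>)
      then show "cross k A u w i * (sqrt \<circ> \<xi>) i = 0" by simp
    qed
    have eig: "cmod (of_real (A u u k k * y\<^sup>2) * f u + of_real y * (\<Sum>w\<in>L. of_real (E u w) * f w)
         + (\<Sum>w\<in>L. of_real (F u w) * f w) - \<mu> * f u) \<le> \<delta> / 2" if u: "u \<in> L" for u
    proof -
      have "(\<Sum>w\<in>L. of_real (A u w k k * y\<^sup>2) * f w) = (\<Sum>w\<in>{u}. of_real (A u w k k * y\<^sup>2) * f w)"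
      proof (rule sum.mono_neutral_right[OF finL])
        show "\<forall>w\<in>L - {u}. complex_of_real (A u w k k * y\<^sup>2) * f w = 0"
        proof
          fix w assume w: "w \<in> L - {u}"
          have "A u w k k = 0"
            using good_support[OF g u, of w k k] w by (auto simp: nbr_def)
          then show "complex_of_real (A u w k k * y\<^sup>2) * f w = 0" by simp
        qed
      qed (use u in auto)
      then have "(\<Sum>w\<in>L. of_real (sysmat (insert k R) (sqrt \<circ> \<xi>) A u w) * f w)
        = of_real (A u u k k * y\<^sup>2) * f u + of_real y * (\<Sum>w\<in>L. of_real (E u w) * f w)
         + (\<Sum>w\<in>L. of_real (F u w) * f w)"
        by (simp add: sysmat_insert[OF k] F_def E_def y_def algebra_simps sum.distrib sum_distrib_left)
      then show ?thesis using ae u by (auto simp: approx_eig_def)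
    qed
    have d2: "\<delta> / 2 \<le> 1" using pos by simp
    have gap: "\<bar>r - A z z k k\<bar> \<ge> gp" if "z \<in> L" "A z z k k \<noteq> r" for z
      using gp(2)[OF u0(1) that(1)] that(2) by (simp add: r_def)
    have f1': "cmod (f u) \<le> 1" if "u \<in> L" for u using f1 that by blast
    have yb: "y \<ge> 2 * (2 * B + 1) / gp" using yT(2) by (simp add: b_def)
    have r0: "A u0 u0 k k = r" by (simp add: r_def)
    have off: "cmod (f z) \<le> 2 * b / gp / y" if "z \<in> L - level k r L A" for z
      unfolding b_def
      by (rule schur_step(1)[where d = "\<lambda>u. A u u k k" and r = r and g = gp and E = E and F = F
            and \<delta> = "\<delta> / 2" and L = L and \<mu> = \<mu>];
          fact finL B0 EB FB gp(1) gap E0 f1' yT(1) yb d2 eig u0 r0 that[unfolded level_def])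
    have on: "cmod ((\<Sum>w\<in>level k r L A. of_real (F u w + (\<Sum>z\<in>L - level k r L A. E u z * E z w / (r - A z z k k))) * f w)
            - (\<mu> - of_real (r * y\<^sup>2)) * f u) \<le> \<delta> / 2 + C / y" if "u \<in> level k r L A" for u
      unfolding b_def C_def level_def
      by (rule schur_step(2)[where d = "\<lambda>u. A u u k k" and r = r and g = gp and E = E and F = F
            and \<delta> = "\<delta> / 2" and L = L and \<mu> = \<mu>];
          fact finL B0 EB FB gp(1) gap E0 f1' yT(1) yb d2 eig u0 r0 that[unfolded level_def])
    have "x / y \<le> \<theta>" if "x / \<theta> \<le> y" for x using that yT(1) pos by (simp add: field_simps)
    then have "2 * b / gp / y \<le> \<theta>" using yT(3) by blast
    then have 1: "\<forall>z\<in>L - level k r L A. cmod (f z) \<le> \<theta>" using off by force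
    have "C / y \<le> \<delta> / 2" using yT(1,4) pos by (simp add: field_simps)
    then have "approx_eig R (sqrt \<circ> \<xi>) (level k r L A) (schur k r L A) f (\<mu> - of_real (r * \<xi> k)) \<delta>"
      unfolding approx_eig_def sysmat_schur
      by (intro ballI order_trans[OF on[unfolded F_def E_def y2]]) linarith+
    then show "approx_eig R (sqrt \<circ> \<xi>) (level k (A u0 u0 k k) L A) (schur k (A u0 u0 k k) L A) f
        (\<mu> - of_real (A u0 u0 k k * \<xi> k)) \<delta>" by (simp add: r_def)
    show "\<forall>z\<in>L - level k (A u0 u0 k k) L A. cmod (f z) \<le> \<theta>" using 1 by (simp add: r_def)
  qed
qed

definition concentrated ::
  "'m set \<Rightarrow> ('m \<Rightarrow> real) \<Rightarrow> (int ^ ('m::finite)) set \<Rightarrow> 'm coef \<Rightarrow> real \<Rightarrow> real \<Rightarrow> bool" where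
  "concentrated R \<xi> L A \<theta> \<delta> \<longleftrightarrow> (\<forall>f \<mu>. (\<forall>u\<in>L. cmod (f u) \<le> 1) \<longrightarrow> (\<exists>u\<in>L. cmod (f u) = 1) \<longrightarrow>
     approx_eig R (sqrt \<circ> \<xi>) L A f \<mu> \<delta> \<longrightarrow>
     (\<exists>u\<in>L. cmod (f u) = 1 \<and> (\<forall>w\<in>L. (\<exists>i\<in>R. \<not> 4 dvd w $ i - u $ i) \<longrightarrow> cmod (f w) \<le> \<theta>)))"

lemma concentratedD:
  assumes "concentrated R \<xi> L A \<theta> \<delta>" "\<forall>u\<in>L. cmod (f u) \<le> 1" "\<exists>u\<in>L. cmod (f u) = 1"
    and "approx_eig R (sqrt \<circ> \<xi>) L A f \<mu> \<delta>"
  shows "\<exists>u\<in>L. cmod (f u) = 1 \<and> (\<forall>w\<in>L. (\<exists>i\<in>R. \<not> 4 dvd w $ i - u $ i) \<longrightarrow> cmod (f w) \<le> \<theta>)"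
  using assms(1)[unfolded concentrated_def, rule_format (no_asm), of f \<mu>] assms(2-4) by simp

text \<open>The induction inserts the dominant parameter: the windows for \<open>R\<close> are
  chosen first, then \<open>\<xi> k\<close> is placed beyond all thresholds determined by them. A
  finite family is treated at once because eliminating \<open>k\<close> turns one system into
  several, one for each diagonal coefficient, and all must share the same windows.\<close>

lemma hierarchy:
  fixes R :: "('m::finite) set" and \<F> :: "((int ^ 'm) set \<times> 'm coef) set"
  assumes "finite R" "finite \<F>" "\<And>L A. (L, A) \<in> \<F> \<Longrightarrow> good R L A" "\<theta> > 0"
  shows "\<exists>l h \<delta>. (\<forall>i. 0 < l i \<and> l i < h i) \<and> 0 < \<delta> \<and> \<delta> \<le> 1 \<and>
    (\<forall>L A \<xi>. (L, A) \<in> \<F> \<longrightarrow> (\<forall>i\<in>R. l i < \<xi> i \<and> \<xi> i < h i) \<longrightarrow> concentrated R \<xi> L A \<theta> \<delta>)"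
  using assms(1,2,3)
proof (induction R arbitrary: \<F> rule: finite_induct)
  case empty
  show ?case
    by (rule exI[of _ "\<lambda>_. 1"], rule exI[of _ "\<lambda>_. 2"], rule exI[of _ 1]) (auto simp: concentrated_def)
next
  case (insert k R)
  \<comment> \<open>All systems that can arise by eliminating \<open>k\<close>; the vertex
    \<open>u\<close> selects the level.\<close>
  define \<F>' where "\<F>' = (\<Union>S\<in>\<F>. (\<lambda>u. (level k (snd S u u k k) (fst S) (snd S), schur k (snd S u u k k) (fst S) (snd S))) ` fst S)"
  have finL: "finite L" if "(L, A) \<in> \<F>" for L A using insert.prems(2)[OF that] by (rule good_finite)
  have fin: "finite \<F>'" unfolding \<F>'_def using insert.prems(1) finL by (intro finite_UN_I) (auto simp: prod_eq_iff)
  have gd: "good R L A" if LA: "(L, A) \<in> \<F>'" for L A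
  proof -
    obtain S u where "S \<in> \<F>" "L = level k (snd S u u k k) (fst S) (snd S)" "A = schur k (snd S u u k k) (fst S) (snd S)"
      using LA unfolding \<F>'_def by blast
    then show ?thesis
      using good_schur[OF insert.prems(2), of "fst S" "snd S" k "snd S u u k k"] insert.hyps by simp
  qed
  obtain l h \<delta> where lh: "\<forall>i. 0 < l i \<and> l i < h i" "0 < \<delta>" "\<delta> \<le> 1"
    and IH: "\<And>L A \<xi>. (L, A) \<in> \<F>' \<Longrightarrow> (\<forall>i\<in>R. l i < \<xi> i \<and> \<xi> i < h i) \<Longrightarrow> concentrated R \<xi> L A \<theta> \<delta>"
    using insert.IH[OF fin gd] by blast
  have "\<forall>S\<in>\<F>. \<exists>T\<ge>0. \<forall>\<xi> f \<mu> u0. (\<forall>i\<in>R. 0 < \<xi> i \<and> \<xi> i < h i) \<longrightarrow> \<xi> k > T \<longrightarrow> (\<forall>u\<in>fst S. cmod (f u) \<le> 1) \<longrightarrow>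
     u0 \<in> fst S \<longrightarrow> cmod (f u0) = 1 \<longrightarrow> approx_eig (insert k R) (sqrt \<circ> \<xi>) (fst S) (snd S) f \<mu> (\<delta> / 2) \<longrightarrow>
     approx_eig R (sqrt \<circ> \<xi>) (level k (snd S u0 u0 k k) (fst S) (snd S)) (schur k (snd S u0 u0 k k) (fst S) (snd S)) f
        (\<mu> - of_real (snd S u0 u0 k k * \<xi> k)) \<delta>
     \<and> (\<forall>z\<in>fst S - level k (snd S u0 u0 k k) (fst S) (snd S). cmod (f z) \<le> \<theta>)"
  proof
    fix S assume "S \<in> \<F>"
    then have "good (insert k R) (fst S) (snd S)" using insert.prems(2)[of "fst S" "snd S"] by simp
    from schur_threshold[OF this insert.hyps(2) assms(4) lh(2,3), of h]
    show "\<exists>T\<ge>0. \<forall>\<xi> f \<mu> u0. (\<forall>i\<in>R. 0 < \<xi> i \<and> \<xi> i < h i) \<longrightarrow> \<xi> k > T \<longrightarrow> (\<forall>u\<in>fst S. cmod (f u) \<le> 1) \<longrightarrow>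
     u0 \<in> fst S \<longrightarrow> cmod (f u0) = 1 \<longrightarrow> approx_eig (insert k R) (sqrt \<circ> \<xi>) (fst S) (snd S) f \<mu> (\<delta> / 2) \<longrightarrow>
     approx_eig R (sqrt \<circ> \<xi>) (level k (snd S u0 u0 k k) (fst S) (snd S)) (schur k (snd S u0 u0 k k) (fst S) (snd S)) f
        (\<mu> - of_real (snd S u0 u0 k k * \<xi> k)) \<delta>
     \<and> (\<forall>z\<in>fst S - level k (snd S u0 u0 k k) (fst S) (snd S). cmod (f z) \<le> \<theta>)" .
  qed
  then obtain T where T0: "\<And>S. S \<in> \<F> \<Longrightarrow> T S \<ge> 0"
    and T: "\<And>S \<xi> f \<mu> u0. S \<in> \<F> \<Longrightarrow> \<forall>i\<in>R. 0 < \<xi> i \<and> \<xi> i < h i \<Longrightarrow> \<xi> k > T S \<Longrightarrow> \<forall>u\<in>fst S. cmod (f u) \<le> 1 \<Longrightarrow>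
     u0 \<in> fst S \<Longrightarrow> cmod (f u0) = 1 \<Longrightarrow> approx_eig (insert k R) (sqrt \<circ> \<xi>) (fst S) (snd S) f \<mu> (\<delta> / 2) \<Longrightarrow>
     approx_eig R (sqrt \<circ> \<xi>) (level k (snd S u0 u0 k k) (fst S) (snd S)) (schur k (snd S u0 u0 k k) (fst S) (snd S)) f
        (\<mu> - of_real (snd S u0 u0 k k * \<xi> k)) \<delta>
     \<and> (\<forall>z\<in>fst S - level k (snd S u0 u0 k k) (fst S) (snd S). cmod (f z) \<le> \<theta>)"
    unfolding bchoice_iff by blast
  \<comment> \<open>The sum dominates every single threshold, and the 1 makes the lower end of the
    window for \<open>\<xi> k\<close> positive.\<close>
  define M where "M = 1 + (\<Sum>S\<in>\<F>. T S)"
  have TM: "T S \<le> M" if "S \<in> \<F>" for S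
    unfolding M_def using member_le_sum[OF that, of T] T0 insert.prems(1) by fastforce
  have M: "M > 0" unfolding M_def using T0 by (simp add: add_pos_nonneg sum_nonneg)
  show ?case
  proof (rule exI[of _ "l(k := M)"], rule exI[of _ "h(k := M + 1)"], rule exI[of _ "\<delta> / 2"],
      intro conjI allI impI, goal_cases)
    case (1 i) then show ?case using lh M by simp
  next
    case (2 i) then show ?case using lh by simp
  next
    case 3 then show ?case using lh by simp
  next
    case 4 then show ?case using lh by simp
  next
    case (5 L A \<xi>)
    have LA: "(L, A) \<in> \<F>" using 5 by blast
    have gdA: "good (insert k R) L A" by (rule insert.prems(2)[OF LA])
    have \<xi>: "\<forall>i\<in>insert k R. (l(k := M)) i < \<xi> i \<and> \<xi> i < (h(k := M + 1)) i" using 5 by blast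
    show "concentrated (insert k R) \<xi> L A \<theta> (\<delta> / 2)"
      unfolding concentrated_def
    proof (intro allI impI)
      fix f :: "int ^ 'm \<Rightarrow> complex" and \<mu>
      assume f1: "\<forall>u\<in>L. cmod (f u) \<le> 1" and "\<exists>u\<in>L. cmod (f u) = 1"
        and ae: "approx_eig (insert k R) (sqrt \<circ> \<xi>) L A f \<mu> (\<delta> / 2)"
      then obtain u0 where u0: "u0 \<in> L" "cmod (f u0) = 1" by blast
      have \<xi>k: "\<xi> k > M" using \<xi> by simp
      have \<xi>R: "\<forall>i\<in>R. l i < \<xi> i \<and> \<xi> i < h i"
      proof
        fix i assume i: "i \<in> R"
        then have "i \<noteq> k" using insert.hyps by blast
        then show "l i < \<xi> i \<and> \<xi> i < h i" using bspec[OF \<xi>, of i] i by simp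
      qed
      have \<xi>pos: "\<forall>i\<in>R. 0 < \<xi> i \<and> \<xi> i < h i" using \<xi>R lh(1) by (meson order.strict_trans)
      let ?L = "level k (A u0 u0 k k) L A" and ?A = "schur k (A u0 u0 k k) L A"
      have TT: "approx_eig R (sqrt \<circ> \<xi>) ?L ?A f (\<mu> - of_real (A u0 u0 k k * \<xi> k)) \<delta>"
        "\<forall>z\<in>L - ?L. cmod (f z) \<le> \<theta>"
        using T[OF LA \<xi>pos, of f u0 \<mu>] TM[OF LA] \<xi>k f1 u0 ae by auto
      have "(?L, ?A) \<in> \<F>'" unfolding \<F>'_def
        by (rule UN_I[OF LA], rule image_eqI[where x = u0]) (use u0 in simp_all)
      from IH[OF this \<xi>R] have "concentrated R \<xi> ?L ?A \<theta> \<delta>" .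
      moreover have "\<forall>u\<in>?L. cmod (f u) \<le> 1" "\<exists>u\<in>?L. cmod (f u) = 1" using f1 u0 by (auto simp: level_def)
      ultimately obtain u where u: "u \<in> ?L" "cmod (f u) = 1"
        "\<And>w. w \<in> ?L \<Longrightarrow> \<exists>i\<in>R. \<not> 4 dvd w $ i - u $ i \<Longrightarrow> cmod (f w) \<le> \<theta>"
        using TT(1) unfolding concentrated_def by blast
      show "\<exists>u\<in>L. cmod (f u) = 1 \<and> (\<forall>w\<in>L. (\<exists>i\<in>insert k R. \<not> 4 dvd w $ i - u $ i) \<longrightarrow> cmod (f w) \<le> \<theta>)"
      proof (intro bexI[of _ u] conjI ballI impI)
        fix w assume w: "w \<in> L" "\<exists>i\<in>insert k R. \<not> 4 dvd w $ i - u $ i"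
        show "cmod (f w) \<le> \<theta>"
        proof (cases "w \<in> ?L")
          case True
          \<comment> \<open>Inside the level coordinate \<open>k\<close> is automatically congruent,
            so the failing congruence concerns a coordinate in \<open>R\<close>.\<close>
          have "4 dvd w $ k - u $ k" using level_dvd[OF gdA _ u(1) True] by simp
          then show ?thesis using w u(3)[OF True] by blast
        next
          case False
          then show ?thesis using TT(2) w by blast
        qed
      qed (use u in \<open>auto simp: level_def\<close>)
    qed
  qed
qed

section \<open>A polynomial expressing genericity\<close>

definition monom_eval :: "('v::finite \<Rightarrow>\<^sub>0 nat) \<Rightarrow> ('v \<Rightarrow> real) \<Rightarrow> real" where
  "monom_eval t x = (\<Prod>i\<in>UNIV. x i ^ Poly_Mapping.lookup t i)"

lemma mpoly_eval_superset:
  fixes P :: "('v::finite) mpoly_real"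
  assumes "finite T" "Poly_Mapping.keys P \<subseteq> T"
  shows "mpoly_eval P x = (\<Sum>t\<in>T. Poly_Mapping.lookup P t * monom_eval t x)"
proof -
  have "(\<Prod>i\<in>Poly_Mapping.keys t. x i ^ Poly_Mapping.lookup t i) = monom_eval t x" for t :: "'v \<Rightarrow>\<^sub>0 nat"
    unfolding monom_eval_def by (rule prod.mono_neutral_left) (auto simp: in_keys_iff)
  then have "mpoly_eval P x = (\<Sum>t\<in>Poly_Mapping.keys P. Poly_Mapping.lookup P t * monom_eval t x)"
    by (simp add: mpoly_eval_def)
  also have "\<dots> = (\<Sum>t\<in>T. Poly_Mapping.lookup P t * monom_eval t x)"
    by (rule sum.mono_neutral_left) (use assms in \<open>auto simp: in_keys_iff\<close>)
  finally show ?thesis .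
qed

lemma mpoly_eval_add: "mpoly_eval (P + P') x = mpoly_eval P x + mpoly_eval P' x"
  for P :: "('v::finite) mpoly_real"
proof -
  let ?T = "Poly_Mapping.keys P \<union> Poly_Mapping.keys P'"
  have "finite ?T" "Poly_Mapping.keys (P + P') \<subseteq> ?T" by (simp_all add: keys_add)
  then show ?thesis
    by (simp add: mpoly_eval_superset[of ?T] lookup_add algebra_simps sum.distrib)
qed

lemma mpoly_eval_single:
  "mpoly_eval (Poly_Mapping.single t c) x = c * monom_eval t x" for t :: "('v::finite) \<Rightarrow>\<^sub>0 nat"
  by (subst mpoly_eval_superset[of "{t}"]) auto

text \<open>Passing to the represented functions reduces the construction of a polynomial to closure
  under sums and products.\<close>

definition polynomial_fun :: "(('v::finite \<Rightarrow> real) \<Rightarrow> real) \<Rightarrow> bool" where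
  "polynomial_fun F \<longleftrightarrow> (\<exists>P. \<forall>x. mpoly_eval P x = F x)"

lemma polynomial_fun_add:
  assumes "polynomial_fun F" "polynomial_fun G"
  shows "polynomial_fun (\<lambda>x. F x + G x)"
proof -
  obtain P P' where "\<And>x. mpoly_eval P x = F x" "\<And>x. mpoly_eval P' x = G x"
    using assms by (auto simp: polynomial_fun_def)
  then have "mpoly_eval (P + P') x = F x + G x" for x by (simp add: mpoly_eval_add)
  then show ?thesis unfolding polynomial_fun_def by blast
qed

lemma polynomial_fun_monom: "polynomial_fun (\<lambda>x. c * monom_eval t x)"
  unfolding polynomial_fun_def using mpoly_eval_single by blast

lemma polynomial_fun_const: "polynomial_fun (\<lambda>x. c)"
  using polynomial_fun_monom[of c 0] by (simp add: monom_eval_def)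

lemma polynomial_fun_var: "polynomial_fun (\<lambda>x. x i)"
proof -
  have "monom_eval (Poly_Mapping.single i 1) x = x i" for x :: "'a \<Rightarrow> real"
  proof -
    have "monom_eval (Poly_Mapping.single i 1) x = (\<Prod>j\<in>UNIV. if j = i then x i else 1)"
      unfolding monom_eval_def by (intro prod.cong refl) (auto simp: lookup_single)
    then show ?thesis by simp
  qed
  then show ?thesis using polynomial_fun_monom[of 1 "Poly_Mapping.single i 1"] by simp
qed

lemma polynomial_fun_sum:
  "(\<And>s. s \<in> S \<Longrightarrow> polynomial_fun (F s)) \<Longrightarrow> polynomial_fun (\<lambda>x. \<Sum>s\<in>S. F s x)"
  by (induction S rule: infinite_finite_induct) (auto intro: polynomial_fun_add polynomial_fun_const)

lemma polynomial_fun_mult: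
  assumes "polynomial_fun F" "polynomial_fun G"
  shows "polynomial_fun (\<lambda>x. F x * G x)"
proof -
  obtain P P' where P: "\<And>x. mpoly_eval P x = F x" and P': "\<And>x. mpoly_eval P' x = G x"
    using assms by (auto simp: polynomial_fun_def)
  have mono: "monom_eval s x * monom_eval t x = monom_eval (s + t) x" for s t and x :: "'a \<Rightarrow> real"
    by (simp add: monom_eval_def lookup_add power_add prod.distrib)
  have "F x * G x = (\<Sum>s\<in>Poly_Mapping.keys P. \<Sum>t\<in>Poly_Mapping.keys P'.
      (Poly_Mapping.lookup P s * Poly_Mapping.lookup P' t) * monom_eval (s + t) x)" for x
    unfolding P[symmetric] P'[symmetric] mpoly_eval_superset[OF finite_keys order_refl] sum_product
      mono[symmetric] by (simp add: mult_ac)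
  then show ?thesis by (simp add: polynomial_fun_sum polynomial_fun_monom)
qed

lemma polynomial_fun_prod:
  "(\<And>s. s \<in> S \<Longrightarrow> polynomial_fun (F s)) \<Longrightarrow> polynomial_fun (\<lambda>x. \<Prod>s\<in>S. F s x)"
  by (induction S rule: infinite_finite_induct) (auto intro: polynomial_fun_mult polynomial_fun_const)

lemma polynomial_fun_line:
  fixes F :: "('v::finite \<Rightarrow> real) \<Rightarrow> real"
  assumes "polynomial_fun F"
  obtains p where "\<And>s. poly p s = F (\<lambda>i. x i + s * d i)"
proof -
  obtain P where P: "\<And>x. mpoly_eval P x = F x" using assms by (auto simp: polynomial_fun_def)
  define p where "p = (\<Sum>t\<in>Poly_Mapping.keys P. smult (Poly_Mapping.lookup P t)
    (\<Prod>i\<in>UNIV. [:x i, d i:] ^ Poly_Mapping.lookup t i))"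
  have "poly p s = F (\<lambda>i. x i + s * d i)" for s
    unfolding P[symmetric] mpoly_eval_superset[OF finite_keys order_refl]
    by (simp add: p_def monom_eval_def poly_sum poly_prod)
  then show ?thesis by (rule that)
qed

text \<open>On the line through \<open>x\<close> and \<open>y\<close> both functions become nonzero
  polynomials in one variable, and their product has only finitely many roots.\<close>

lemma polynomial_fun_common_nonzero:
  assumes "polynomial_fun F" "polynomial_fun G" "F x \<noteq> 0" "G y \<noteq> 0"
  shows "\<exists>z. F z * G z \<noteq> 0"
proof -
  obtain p where p: "\<And>s. poly p s = F (\<lambda>i. x i + s * (y i - x i))"
    using polynomial_fun_line[OF assms(1), of x "\<lambda>i. y i - x i"] by blast
  obtain q where q: "\<And>s. poly q s = G (\<lambda>i. x i + s * (y i - x i))"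
    using polynomial_fun_line[OF assms(2), of x "\<lambda>i. y i - x i"] by blast
  have "poly p 0 \<noteq> 0" "poly q 1 \<noteq> 0" using p q assms by simp_all
  then have "p * q \<noteq> 0" by auto
  then have "finite {s. poly (p * q) s = 0}" by (rule poly_roots_finite)
  then obtain s where "poly (p * q) s \<noteq> 0"
    using ex_new_if_finite[OF infinite_UNIV_char_0] by blast
  then show ?thesis using p q by auto
qed

lemma polynomial_fun_prod_nonzero:
  assumes "finite S" "\<And>s. s \<in> S \<Longrightarrow> polynomial_fun (F s)" "\<And>s. s \<in> S \<Longrightarrow> \<exists>x. F s x \<noteq> 0"
  shows "\<exists>x. (\<Prod>s\<in>S. F s x) \<noteq> 0"
  using assms
proof (induction S rule: finite_induct)
  case (insert s S)
  then obtain x where "F s x \<noteq> 0" by blast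
  moreover obtain y where "(\<Prod>s\<in>S. F s y) \<noteq> 0" using insert by auto
  ultimately have "\<exists>z. F s z * (\<Prod>s\<in>S. F s z) \<noteq> 0"
    using insert.prems by (intro polynomial_fun_common_nonzero polynomial_fun_prod) auto
  then show ?case using insert.hyps by simp
qed simp

text \<open>If \<open>v = \<Sum> r\<^sub>b b\<close> over an independent set, then \<open>v v\<^sup>T = \<Sum> r\<^sub>b b b\<^sup>T\<close> forces \<open>v\<close> to be one of
  the \<open>b\<close>, as one sees by applying a functional dual to some \<open>b\<close> with \<open>r\<^sub>b \<noteq> 0\<close>.\<close>

lemma quadratic_relation:
  fixes V :: "(real ^ 'm) set"
  assumes fin: "finite V" and nz: "0 \<notin> V" and card: "card V > CARD('m)"
  shows "\<exists>c. (\<Sum>x\<in>V. c x *\<^sub>R x) = 0 \<and> (\<exists>i j. (\<Sum>x\<in>V. c x * (x $ i * x $ j)) \<noteq> 0)"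
proof -
  obtain B where B: "B \<subseteq> V" "independent B" "V \<subseteq> span B"
    using maximal_independent_subset[of V] by blast
  have finB: "finite B" using B(1) fin by (rule finite_subset)
  have "card B \<le> CARD('m)" using independent_bound[OF B(2)] by simp
  then have "B \<noteq> V" using card by auto
  then obtain v where v: "v \<in> V" "v \<notin> B" using B(1) by blast
  have "v \<in> span B" using v B(3) by blast
  then obtain r where r: "v = (\<Sum>b\<in>B. r b *\<^sub>R b)" unfolding span_finite[OF finB] by auto
  define c where "c x = (if x = v then - 1 else if x \<in> B then r x else 0)" for x
  have red: "(\<Sum>x\<in>V. c x *\<^sub>R h x) = (\<Sum>b\<in>B. r b *\<^sub>R h b) - h v" for h :: "real ^ 'm \<Rightarrow> 'z::real_vector"
  proof -
    have "(\<Sum>x\<in>V. c x *\<^sub>R h x) = (\<Sum>x\<in>insert v B. c x *\<^sub>R h x)"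
      by (rule sum.mono_neutral_right[OF fin]) (use v B(1) in \<open>auto simp: c_def\<close>)
    also have "\<dots> = (\<Sum>b\<in>B. c b *\<^sub>R h b) - h v" using finB v(2) by (simp add: c_def)
    also have "(\<Sum>b\<in>B. c b *\<^sub>R h b) = (\<Sum>b\<in>B. r b *\<^sub>R h b)"
      by (intro sum.cong refl) (use v(2) in \<open>auto simp: c_def\<close>)
    finally show ?thesis .
  qed
  have "\<exists>b0\<in>B. r b0 \<noteq> 0"
  proof (rule ccontr)
    assume "\<not> (\<exists>b0\<in>B. r b0 \<noteq> 0)"
    then have "v = 0" using r by simp
    then show False using v nz by simp
  qed
  then obtain b0 where b0: "b0 \<in> B" "r b0 \<noteq> 0" by blast
  obtain \<phi> :: "real ^ 'm \<Rightarrow> real" where \<phi>: "linear \<phi>" "\<And>b. b \<in> B \<Longrightarrow> \<phi> b = (if b = b0 then 1 else 0)"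
    using linear_independent_extend[OF B(2), of "\<lambda>b. if b = b0 then 1 else 0"] by blast
  have \<phi>r: "(\<Sum>b\<in>B. r b *\<^sub>R (\<phi> b *\<^sub>R h b)) = r b0 *\<^sub>R h b0" for h :: "real ^ 'm \<Rightarrow> 'z::real_vector"
  proof -
    have "(\<Sum>b\<in>B. r b *\<^sub>R (\<phi> b *\<^sub>R h b)) = (\<Sum>b\<in>B. if b = b0 then r b0 *\<^sub>R h b0 else 0)"
      by (intro sum.cong refl) (simp add: \<phi>(2))
    then show ?thesis using b0(1) finB by simp
  qed
  have \<phi>v: "\<phi> v = r b0"
    using \<phi>r[of "\<lambda>_. 1::real"] unfolding r linear_sum[OF \<phi>(1)] linear_cmul[OF \<phi>(1)] by simp
  have "\<exists>i j. (\<Sum>x\<in>V. c x * (x $ i * x $ j)) \<noteq> 0"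
  proof (rule ccontr)
    assume "\<not> ?thesis"
    then have all0: "(\<Sum>x\<in>V. c x * (x $ i * x $ j)) = 0" for i j by blast
    define p where "p i = \<phi> (axis i 1)" for i
    have coord: "\<phi> x = (\<Sum>i\<in>UNIV. x $ i * p i)" for x
    proof -
      have "x = (\<Sum>i\<in>UNIV. x $ i *\<^sub>R axis i 1)"
        by (simp add: vec_eq_iff axis_def if_distrib[where f = "(*) _"] cong: if_cong)
      then have "\<phi> x = \<phi> (\<Sum>i\<in>UNIV. x $ i *\<^sub>R axis i 1)" by (rule arg_cong)
      then show ?thesis by (simp add: linear_sum[OF \<phi>(1)] linear_cmul[OF \<phi>(1)] p_def)
    qed
    have "(\<Sum>x\<in>V. c x *\<^sub>R (\<phi> x *\<^sub>R x)) = 0"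
    proof -
      have "(\<Sum>x\<in>V. c x * (\<phi> x * x $ j)) = 0" for j
      proof -
        have "(\<Sum>x\<in>V. c x * (\<phi> x * x $ j)) = (\<Sum>x\<in>V. \<Sum>i\<in>UNIV. p i * (c x * (x $ i * x $ j)))"
          by (simp add: coord sum_distrib_left sum_distrib_right mult_ac)
        also have "\<dots> = (\<Sum>i\<in>UNIV. p i * (\<Sum>x\<in>V. c x * (x $ i * x $ j)))"
          unfolding sum_distrib_left by (rule sum.swap)
        finally show ?thesis by (simp add: all0)
      qed
      then show ?thesis by (simp add: vec_eq_iff mult.assoc)
    qed
    \<comment> \<open>Contracting the quadratic relation with the functional dual to
      \<open>b0\<close> leaves one term on each side, and \<open>\<phi> v\<close> equals
      \<open>r b0\<close>.\<close>
    then have "r b0 *\<^sub>R b0 = \<phi> v *\<^sub>R v" unfolding red \<phi>r by simp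
    then have "b0 = v" using b0(2) \<phi>v by simp
    then show False using b0(1) v(2) by simp
  qed
  moreover have "(\<Sum>x\<in>V. c x *\<^sub>R x) = 0" using red[of "\<lambda>x. x"] r by simp
  ultimately show ?thesis by blast
qed

lemma quadratic_relation_int:
  fixes G :: "(int ^ 'm) set"
  assumes fin: "finite G" and nz: "0 \<notin> G" and card: "card G > CARD('m)"
  shows "\<exists>c. (\<forall>i. (\<Sum>g\<in>G. c g * of_int (g $ i)) = (0::real))
      \<and> (\<exists>i j. (\<Sum>g\<in>G. c g * (of_int (g $ i) * of_int (g $ j))) \<noteq> 0)"
proof -
  define \<rho> :: "int ^ 'm \<Rightarrow> real ^ 'm" where "\<rho> g = (\<chi> i. of_int (g $ i))" for g
  have inj: "inj_on \<rho> G" by (auto simp: inj_on_def \<rho>_def vec_eq_iff)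
  have "g = 0" if "\<rho> g = 0" for g using that by (simp add: \<rho>_def vec_eq_iff)
  then have "0 \<notin> \<rho> ` G" using nz by force
  then obtain c i j where c: "(\<Sum>x\<in>\<rho> ` G. c x *\<^sub>R x) = 0" "(\<Sum>x\<in>\<rho> ` G. c x * (x $ i * x $ j)) \<noteq> 0"
    using quadratic_relation[of "\<rho> ` G"] fin card card_image[OF inj] by auto
  have 1: "(\<Sum>g\<in>G. c (\<rho> g) *\<^sub>R \<rho> g) = 0" using c(1) by (simp add: sum.reindex[OF inj])
  have "(\<Sum>g\<in>G. c (\<rho> g) * of_int (g $ l)) = 0" for l
    using arg_cong[OF 1, of "\<lambda>x. x $ l"] by (simp add: \<rho>_def)
  moreover have "(\<Sum>g\<in>G. c (\<rho> g) * (of_int (g $ i) * of_int (g $ j))) \<noteq> 0"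
    using c(2) unfolding sum.reindex[OF inj] by (simp add: \<rho>_def)
  ultimately show ?thesis by (intro exI[of _ "\<lambda>g. c (\<rho> g)"]) auto
qed

text \<open>The polynomial is the product over the finitely many admissible subsets \<open>G\<close>
  of \<open>D\<close>, each contributing the quadratic form of a relation provided by
  \<open>quadratic_relation_int\<close>. That relation is linear in \<open>g\<close> but not
  quadratic, so no factor vanishes identically.\<close>

lemma generic_polynomial:
  fixes D :: "(int ^ ('m::finite)) set"
  assumes "finite D"
  shows "\<exists>P :: ('m \<times> 'n::finite) mpoly_real. P \<noteq> 0 \<and>
    (\<forall>v :: int ^ 'n ^ 'm. mpoly_eval P (\<lambda>(i, k). of_int (v $ i $ k)) \<noteq> 0 \<longrightarrow>
      (\<forall>G\<subseteq>D. 0 \<notin> G \<longrightarrow> card G > CARD('m) \<longrightarrow>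
        (\<exists>c. (\<forall>i. (\<Sum>g\<in>G. c g * of_int (g $ i)) = (0::real))
          \<and> (\<Sum>g\<in>G. c g * of_int (sqnorm (\<pi>\<^sub>S v g))) \<noteq> 0)))"
proof -
  define \<G> where "\<G> = {G. G \<subseteq> D \<and> 0 \<notin> G \<and> card G > CARD('m)}"
  have fin: "finite \<G>" unfolding \<G>_def by (rule finite_subset[of _ "Pow D"]) (use assms in auto)
  have "\<forall>G\<in>\<G>. \<exists>c. (\<forall>i. (\<Sum>g\<in>G. c g * of_int (g $ i)) = (0::real))
      \<and> (\<exists>i j. (\<Sum>g\<in>G. c g * (of_int (g $ i) * of_int (g $ j))) \<noteq> 0)"
  proof
    fix G assume "G \<in> \<G>"
    then have "finite G" "0 \<notin> G" "card G > CARD('m)" using finite_subset[OF _ assms] by (auto simp: \<G>_def)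
    then show "\<exists>c. (\<forall>i. (\<Sum>g\<in>G. c g * of_int (g $ i)) = (0::real))
      \<and> (\<exists>i j. (\<Sum>g\<in>G. c g * (of_int (g $ i) * of_int (g $ j))) \<noteq> 0)"
      by (rule quadratic_relation_int)
  qed
  from bchoice[OF this] obtain c where "\<forall>G\<in>\<G>. (\<forall>i. (\<Sum>g\<in>G. c G g * of_int (g $ i)) = (0::real))
      \<and> (\<exists>i j. (\<Sum>g\<in>G. c G g * (of_int (g $ i) * of_int (g $ j))) \<noteq> 0)" by blast
  then have c: "\<And>G i. G \<in> \<G> \<Longrightarrow> (\<Sum>g\<in>G. c G g * of_int (g $ i)) = (0::real)"
    and cq: "\<And>G. G \<in> \<G> \<Longrightarrow> \<exists>i j. (\<Sum>g\<in>G. c G g * (of_int (g $ i) * of_int (g $ j))) \<noteq> 0"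
    by blast+
  define F :: "(int ^ 'm) set \<Rightarrow> ('m \<times> 'n \<Rightarrow> real) \<Rightarrow> real"
    where "F G x = (\<Sum>g\<in>G. c G g * (\<Sum>k\<in>UNIV. (\<Sum>i\<in>UNIV. of_int (g $ i) * x (i, k)) * (\<Sum>i\<in>UNIV. of_int (g $ i) * x (i, k))))"
    for G x
  have poly: "polynomial_fun (F G)" for G
    unfolding F_def by (intro polynomial_fun_sum polynomial_fun_mult polynomial_fun_const polynomial_fun_var)
  have nonzero: "\<exists>x. F G x \<noteq> 0" if G: "G \<in> \<G>" for G
  proof (rule ccontr)
    assume "\<not> ?thesis"
    then have F0: "F G x = 0" for x by blast
    define q where "q t = (\<Sum>g\<in>G. c G g * (\<Sum>i\<in>UNIV. of_int (g $ i) * t i)\<^sup>2)" for t :: "'m \<Rightarrow> real"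
    \<comment> \<open>Sites whose coordinates all coincide turn \<open>F G\<close> into
      \<open>CARD('n)\<close> times the quadratic form \<open>q\<close>.\<close>
    have q0: "q t = 0" for t
      using F0[of "\<lambda>(i, k). t i"]
      by (simp add: F_def q_def power2_eq_square mult.left_commute[of _ "of_nat _"] flip: sum_distrib_left)
    obtain i j where ij: "(\<Sum>g\<in>G. c G g * (of_int (g $ i) * of_int (g $ j))) \<noteq> 0" using cq[OF G] by blast
    define e :: "'m \<Rightarrow> 'm \<Rightarrow> real" where "e i l = (if l = i then 1 else 0)" for i l
    have eval: "(\<Sum>l\<in>UNIV. of_int (g $ l) * e i l) = of_int (g $ i)" for i and g :: "int ^ 'm"
      by (simp add: e_def if_distrib[where f = "(*) _"] cong: if_cong)
    \<comment> \<open>Polarization recovers the mixed coefficient of \<open>q\<close> at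
      \<open>i\<close> and \<open>j\<close>.\<close>
    have "q (\<lambda>l. e i l + e j l) - q (e i) - q (e j) = 2 * (\<Sum>g\<in>G. c G g * (of_int (g $ i) * of_int (g $ j)))"
    proof -
      have "(\<Sum>l\<in>UNIV. of_int (g $ l) * (e i l + e j l)) = (of_int (g $ i) + of_int (g $ j) :: real)" for g :: "int ^ 'm"
        by (simp add: distrib_left sum.distrib eval)
      then show ?thesis
        unfolding q_def eval by (simp add: power2_sum distrib_left sum.distrib sum_distrib_left mult_ac)
    qed
    then show False using q0 ij by simp
  qed
  obtain x0 where x0: "(\<Prod>G\<in>\<G>. F G x0) \<noteq> 0"
    using polynomial_fun_prod_nonzero[OF fin, of F] poly nonzero by blast
  obtain P where P: "\<And>x. mpoly_eval P x = (\<Prod>G\<in>\<G>. F G x)"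
    using polynomial_fun_prod[of \<G> F] poly by (auto simp: polynomial_fun_def)
  have "P \<noteq> 0" using P[of x0] x0 by (auto simp: mpoly_eval_def)
  moreover have "\<exists>c. (\<forall>i. (\<Sum>g\<in>G. c g * of_int (g $ i)) = (0::real))
          \<and> (\<Sum>g\<in>G. c g * of_int (sqnorm (\<pi>\<^sub>S v g))) \<noteq> 0"
    if "mpoly_eval P (\<lambda>(i, k). of_int (v $ i $ k)) \<noteq> 0" "G \<subseteq> D" "0 \<notin> G" "card G > CARD('m)"
    for G and v :: "int ^ 'n ^ 'm"
  proof -
    have G: "G \<in> \<G>" using that by (simp add: \<G>_def)
    have "F G (\<lambda>(i, k). of_int (v $ i $ k)) \<noteq> 0" using that(1) G fin by (simp add: P)
    moreover have "F G (\<lambda>(i, k). of_int (v $ i $ k)) = (\<Sum>g\<in>G. c G g * of_int (sqnorm (\<pi>\<^sub>S v g)))"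
      by (simp add: F_def sqnorm_def \<pi>\<^sub>S_def power2_eq_square)
    ultimately show ?thesis using c[OF G] by auto
  qed
  ultimately show ?thesis by blast
qed

text \<open>Comparing the energies at \<open>a0 + g\<close> and \<open>a0\<close> shows that
  \<open>sqnorm (\<pi>\<^sub>S v g)\<close> is linear in the difference \<open>g\<close>. Every
  linear relation among differences then annihilates these norms too, which \<open>gen\<close>
  forbids for more than \<open>CARD('m)\<close> of them. The additional 1 counts
  \<open>a0\<close>.\<close>

lemma energy_card_le:
  fixes v :: "int ^ ('n::finite) ^ ('m::finite)"
  assumes gen: "\<And>G. G \<subseteq> D \<Longrightarrow> 0 \<notin> G \<Longrightarrow> card G > CARD('m) \<Longrightarrow>
        \<exists>c. (\<forall>i. (\<Sum>g\<in>G. c g * of_int (g $ i)) = (0::real))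
          \<and> (\<Sum>g\<in>G. c g * of_int (sqnorm (\<pi>\<^sub>S v g))) \<noteq> 0"
    and diff: "\<And>a b. a \<in> S \<Longrightarrow> b \<in> S \<Longrightarrow> a - b \<in> D"
    and energy: "\<And>a. a \<in> S \<Longrightarrow> sqnorm (\<pi>\<^sub>S v a) + (\<Sum>i\<in>UNIV. a $ i * sqnorm (v $ i)) = \<kappa>"
  shows "card S \<le> CARD('m) + 1"
proof (cases "S = {}")
  case False
  then obtain a0 where a0: "a0 \<in> S" by blast
  define G where "G = (\<lambda>a. a - a0) ` (S - {a0})"
  have cG: "card G = card (S - {a0})" unfolding G_def by (rule card_image) (auto simp: inj_on_def)
  define m where "m i = - (2 * (\<Sum>k\<in>UNIV. \<pi>\<^sub>S v a0 $ k * v $ i $ k) + sqnorm (v $ i))" for i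
  have lin: "sqnorm (\<pi>\<^sub>S v g) = (\<Sum>i\<in>UNIV. g $ i * m i)" if "g \<in> G" for g
  proof -
    have ag: "a0 + g \<in> S" using that by (auto simp: G_def)
    have pi: "\<pi>\<^sub>S v (a0 + g) $ k = \<pi>\<^sub>S v a0 $ k + \<pi>\<^sub>S v g $ k" for k
      by (simp add: \<pi>\<^sub>S_def algebra_simps sum.distrib)
    have ip: "(\<Sum>k\<in>UNIV. \<pi>\<^sub>S v a0 $ k * \<pi>\<^sub>S v g $ k) = (\<Sum>i\<in>UNIV. g $ i * (\<Sum>k\<in>UNIV. \<pi>\<^sub>S v a0 $ k * v $ i $ k))"
    proof -
      have "(\<Sum>k\<in>UNIV. \<pi>\<^sub>S v a0 $ k * \<pi>\<^sub>S v g $ k) = (\<Sum>k\<in>UNIV. \<Sum>i\<in>UNIV. g $ i * (\<pi>\<^sub>S v a0 $ k * v $ i $ k))"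
      proof (rule sum.cong[OF refl])
        fix k
        have "\<pi>\<^sub>S v g $ k = (\<Sum>i\<in>UNIV. g $ i * v $ i $ k)" by (simp add: \<pi>\<^sub>S_def)
        then show "\<pi>\<^sub>S v a0 $ k * \<pi>\<^sub>S v g $ k = (\<Sum>i\<in>UNIV. g $ i * (\<pi>\<^sub>S v a0 $ k * v $ i $ k))"
          by (simp add: sum_distrib_left mult_ac)
      qed
      also have "\<dots> = (\<Sum>i\<in>UNIV. \<Sum>k\<in>UNIV. g $ i * (\<pi>\<^sub>S v a0 $ k * v $ i $ k))" by (rule sum.swap)
      finally show ?thesis by (simp add: sum_distrib_left)
    qed
    have "sqnorm (\<pi>\<^sub>S v (a0 + g)) = sqnorm (\<pi>\<^sub>S v a0) + 2 * (\<Sum>k\<in>UNIV. \<pi>\<^sub>S v a0 $ k * \<pi>\<^sub>S v g $ k) + sqnorm (\<pi>\<^sub>S v g)"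
      by (simp add: sqnorm_def pi power2_sum sum.distrib sum_distrib_left mult_ac)
    moreover have "(\<Sum>i\<in>UNIV. (a0 + g) $ i * sqnorm (v $ i))
        = (\<Sum>i\<in>UNIV. a0 $ i * sqnorm (v $ i)) + (\<Sum>i\<in>UNIV. g $ i * sqnorm (v $ i))"
      by (simp add: distrib_right sum.distrib)
    ultimately have "sqnorm (\<pi>\<^sub>S v g) = - (2 * (\<Sum>k\<in>UNIV. \<pi>\<^sub>S v a0 $ k * \<pi>\<^sub>S v g $ k) + (\<Sum>i\<in>UNIV. g $ i * sqnorm (v $ i)))"
      using energy[OF ag] energy[OF a0] by linarith
    also have "\<dots> = (\<Sum>i\<in>UNIV. g $ i * m i)"
      unfolding ip m_def by (simp add: sum_distrib_left sum.distrib[symmetric] sum_negf[symmetric] algebra_simps)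
    finally show ?thesis .
  qed
  have "\<not> card G > CARD('m)"
  proof
    assume "card G > CARD('m)"
    moreover have "G \<subseteq> D" "0 \<notin> G" using diff a0 by (auto simp: G_def)
    ultimately obtain c where c: "\<And>i. (\<Sum>g\<in>G. c g * of_int (g $ i)) = (0::real)"
      "(\<Sum>g\<in>G. c g * of_int (sqnorm (\<pi>\<^sub>S v g))) \<noteq> 0" using gen by blast
    have "(\<Sum>g\<in>G. c g * of_int (sqnorm (\<pi>\<^sub>S v g))) = (\<Sum>g\<in>G. \<Sum>i\<in>UNIV. of_int (m i) * (c g * of_int (g $ i)))"
      by (intro sum.cong refl) (simp add: lin sum_distrib_left mult_ac)
    also have "\<dots> = (\<Sum>i\<in>UNIV. of_int (m i) * (\<Sum>g\<in>G. c g * of_int (g $ i)))"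
      unfolding sum_distrib_left by (rule sum.swap)
    finally show False using c by simp
  qed
  \<comment> \<open>For infinite \<open>S\<close> the cardinality is 0 by convention and the bound
    is trivial.\<close>
  then show ?thesis using cG card_Diff_singleton[OF a0] by (cases "finite S") auto
qed simp

section \<open>Components of the graph\<close>

text \<open>In terms of \<open>lab\<close>, edges are steps by \<open>\<plusminus> std i \<plusminus> std j\<close> and the \<open>\<xi>\<close>-part of the diagonal of
  \<open>Q\<close> is \<open>- lab u \<bullet> \<xi>\<close> for both signs.\<close>

fun lab :: "('m::finite) grp \<Rightarrow> int ^ 'm" where
  "lab (Pos a) = a"
| "lab (Neg b) = - b"

lemma \<eta>_add: "\<eta> (a + b) = \<eta> a + \<eta> b"
  by (simp add: \<eta>_def sum.distrib)

lemma \<eta>_minus: "\<eta> (- a) = - \<eta> a"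
  by (simp add: \<eta>_def sum_negf)

lemma \<eta>_diff: "\<eta> (a - b) = \<eta> a - \<eta> b"
  by (simp add: \<eta>_def sum_subtractf)

lemma \<eta>_scale: "\<eta> (s *s a) = s * \<eta> a"
  by (simp add: \<eta>_def sum_distrib_left)

lemma \<eta>_std: "\<eta> (std i) = 1"
  by (simp add: \<eta>_def axis_def)

lemma \<eta>_lab: "u \<in> G1 \<Longrightarrow> \<eta> (lab u) = - gsign u"
  by (cases u) (auto simp: G1_def \<eta>_minus)

lemma gsign_cases: "gsign u = 1 \<or> gsign u = - 1"
  by (cases u) auto

text \<open>\<open>Pos a\<close> and \<open>Neg (- a)\<close> share a label, but
  \<open>\<eta>\<close> of the label determines the sign on \<open>G1\<close>, so at most one of
  them lies there.\<close>

lemma inj_on_lab: "inj_on lab G1"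
proof (rule inj_onI)
  fix u w :: "'a grp" assume "u \<in> G1" "w \<in> G1" "lab u = lab w"
  moreover from this have "gsign u = gsign w" using \<eta>_lab by (metis neg_equal_iff_equal)
  ultimately show "u = w" by (cases u; cases w) auto
qed

lemma nbr_swap: "nbr i j a b \<longleftrightarrow> nbr j i a b"
  by (auto simp: nbr_def)

lemma nbr_sym: "nbr i j a b \<longleftrightarrow> nbr i j b a"
  by (auto simp: nbr_def abs_minus_commute)

lemma nbr_iff:
  "nbr i j a b \<longleftrightarrow> i \<noteq> j \<and> (\<exists>s\<in>{1,-1}. \<exists>t\<in>{1,-1}. b = a + s *s std i + t *s std j)"
proof
  assume n: "nbr i j a b"
  then have "b = a + (b $ i - a $ i) *s std i + (b $ j - a $ j) *s std j"
    by (auto simp: nbr_def vec_eq_iff axis_def)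
  moreover have "b $ i - a $ i \<in> {1,-1}" "b $ j - a $ j \<in> {1,-1}" using n by (auto simp: nbr_def)
  ultimately show "i \<noteq> j \<and> (\<exists>s\<in>{1,-1}. \<exists>t\<in>{1,-1}. b = a + s *s std i + t *s std j)"
    using n unfolding nbr_def by blast
next
  assume "i \<noteq> j \<and> (\<exists>s\<in>{1,-1}. \<exists>t\<in>{1,-1}. b = a + s *s std i + t *s std j)"
  then show "nbr i j a b" by (auto simp: nbr_def axis_def)
qed

lemma nbr_unique:
  assumes "nbr i j a b" "nbr k l a b"
  shows "k = i \<and> l = j \<or> k = j \<and> l = i"
  using assms unfolding nbr_def by (metis abs_zero diff_self zero_neq_one)

lemma edge_nbr:
  assumes "edge v x u w" shows "\<exists>i j. nbr i j (lab u) (lab w)"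
proof -
  have w: "w = x \<cdot>\<^sub>G u" using assms by (simp add: edge_def)
  consider i j where "i \<noteq> j" "x = black i j" | i j where "i \<noteq> j" "x = red i j"
    using assms by (auto simp: edge_def X_marks_def)
  then show ?thesis
  proof cases
    case 1
    then have "nbr i j (lab u) (lab w)"
      by (cases u) (auto simp: w black_def nbr_def axis_def)
    then show ?thesis by blast
  next
    case 2
    then have "nbr i j (lab u) (lab w)"
      by (cases u) (auto simp: w red_def nbr_def axis_def)
    then show ?thesis by blast
  qed
qed

text \<open>By \<open>\<eta>\<close> the sum of the two unit steps is the difference of the signs of
  the vertices: opposite steps keep the sign and give a black edge, equal steps change it and give a
  red one.\<close>

lemma nbr_edge:
  assumes n: "nbr i j (lab u) (lab w)" and V: "u \<in> vertices v" "w \<in> vertices v" and K: "K v u = K v w"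
  shows "edge v (black i j) u w \<or> edge v (black j i) u w \<or> edge v (red i j) u w"
proof -
  have G: "u \<in> G1" "w \<in> G1" using V by (auto simp: vertices_def)
  obtain s t where ij: "i \<noteq> j" and st: "s \<in> {1,-1}" "t \<in> {1,-1}"
    and d: "lab w = lab u + s *s std i + t *s std j" using n unfolding nbr_iff by blast
  have "\<eta> (lab w) = \<eta> (lab u) + s + t"
    unfolding d by (simp add: \<eta>_add \<eta>_std \<eta>_scale)
  then have sg: "gsign u - gsign w = s + t" using \<eta>_lab[OF G(1)] \<eta>_lab[OF G(2)] by simp
  have "w = black i j \<cdot>\<^sub>G u \<or> w = black j i \<cdot>\<^sub>G u \<or> w = red i j \<cdot>\<^sub>G u"
  proof (cases u; cases w)
    fix a b assume u: "u = Pos a" "w = Pos b"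
    then have "t = - s" using sg by simp
    then show ?thesis using d u st by (auto simp: black_def algebra_simps simp flip: vector_sneg_minus1)
  next
    fix a b assume u: "u = Neg a" "w = Neg b"
    then have "t = - s" using sg by simp
    moreover have "b = a - s *s std i - t *s std j" using d u by (simp add: minus_equation_iff[of b] algebra_simps)
    ultimately show ?thesis using u st by (auto simp: black_def algebra_simps simp flip: vector_sneg_minus1)
  next
    fix a b assume u: "u = Pos a" "w = Neg b"
    then have "s = 1" "t = 1" using sg st by auto
    then have "- b = a + std i + std j" using d u by simp
    then have "b = - (a + std i + std j)" by (metis minus_minus)
    then show ?thesis using u by (simp add: red_def)
  next
    fix a b assume u: "u = Neg a" "w = Pos b"
    then have "s = - 1" "t = - 1" using sg st by auto
    then have "b = (- std i - std j) - a" using d u by (simp add: vec_eq_iff)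
    then show ?thesis using u by (simp add: red_def)
  qed
  moreover have "black i j \<in> X_marks" "black j i \<in> X_marks" "red i j \<in> X_marks"
    using ij by (auto simp: X_marks_def)
  ultimately show ?thesis using V K unfolding edge_def by blast
qed

lemma coupling_nbr:
  assumes n: "nbr i j (lab u) (lab w)" and V: "u \<in> vertices v" "w \<in> vertices v" and K: "K v u = K v w"
  shows "coupling v \<xi> u w = 2 * sqrt (\<xi> $ i * \<xi> $ j)"
proof -
  have ij: "i \<noteq> j" using n by (simp add: nbr_def)
  from nbr_edge[OF assms] show ?thesis
    using coupling_black[OF ij] coupling_black[of j i v u w \<xi>] coupling_red[OF ij] ij
    by (metis mult.commute)
qed

lemma coupling_not_nbr:
  assumes "\<And>i j. \<not> nbr i j (lab u) (lab w)"
  shows "coupling v \<xi> u w = 0"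
  using assms edge_nbr unfolding coupling_def by meson

text \<open>For \<open>u = Pos a\<close> equality of the energies amounts to \<open>\<bar>\<pi>\<^sub>S v a + v $ i\<bar>\<^sup>2 = 0\<close>, and then \<open>u\<close> is one of
  the excluded elements.\<close>

lemma no_double_step:
  assumes V: "u \<in> vertices v" "w \<in> vertices v" and K: "K v u = K v w"
    and d: "\<bar>lab w $ i - lab u $ i\<bar> = 2" "\<And>l. l \<noteq> i \<Longrightarrow> lab w $ l = lab u $ l"
  shows False
proof -
  have main: False if V: "Pos a \<in> vertices v" and K: "K v (Pos a) = K v (Neg b)" and b: "b = - a - 2 *s std i" for a b
  proof -
    have pb: "\<pi>\<^sub>S v b $ k = - (\<pi>\<^sub>S v a $ k + 2 * v $ i $ k)" for k
    proof -
      have "\<pi>\<^sub>S v b $ k = (\<Sum>l\<in>UNIV. - (a $ l * v $ l $ k) - (if l = i then 2 * v $ i $ k else 0))"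
        by (simp add: \<pi>\<^sub>S_def b axis_def algebra_simps cong: if_cong) (auto intro: sum.cong)
      then show ?thesis by (simp add: sum_subtractf sum_negf \<pi>\<^sub>S_def)
    qed
    have sb: "(\<Sum>l\<in>UNIV. b $ l * sqnorm (v $ l)) = - (\<Sum>l\<in>UNIV. a $ l * sqnorm (v $ l)) - 2 * sqnorm (v $ i)"
    proof -
      have "(\<Sum>l\<in>UNIV. b $ l * sqnorm (v $ l)) = (\<Sum>l\<in>UNIV. - (a $ l * sqnorm (v $ l)) - (if l = i then 2 * sqnorm (v $ i) else 0))"
        by (rule sum.cong) (auto simp: b axis_def algebra_simps)
      then show ?thesis by (simp add: sum_subtractf sum_negf)
    qed
    define x where "x = sqnorm (\<pi>\<^sub>S v a) + (\<Sum>l\<in>UNIV. a $ l * sqnorm (v $ l))"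
    define y where "y = sqnorm (\<pi>\<^sub>S v b) + (\<Sum>l\<in>UNIV. b $ l * sqnorm (v $ l))"
    have "K v (Pos a) = of_int x / 2" "K v (Neg b) = - of_int y / 2" by (simp_all add: K_def Let_def x_def y_def field_simps)
    then have "of_int x = (of_int (- y) :: real)" using K by simp
    then have "x = - y" by (simp only: of_int_eq_iff)
    then have "sqnorm (\<pi>\<^sub>S v a) + sqnorm (\<pi>\<^sub>S v b) = 2 * sqnorm (v $ i)" unfolding x_def y_def sb by simp
    \<comment> \<open>With \<open>\<pi>\<^sub>S v b\<close> equal to
      \<open>- (\<pi>\<^sub>S v a + 2 * v $ i)\<close>, completing the square turns the energy
      equation into the vanishing of a sum of squares.\<close>
    moreover have "sqnorm (\<pi>\<^sub>S v a) + sqnorm (\<pi>\<^sub>S v b) - 2 * sqnorm (v $ i) = 2 * (\<Sum>k\<in>UNIV. (\<pi>\<^sub>S v a $ k + v $ i $ k)\<^sup>2)"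
      unfolding sqnorm_def pb sum_distrib_left sum.distrib[symmetric] sum_subtractf[symmetric]
      by (rule sum.cong) (simp_all add: power2_eq_square algebra_simps)
    ultimately have "(\<Sum>k\<in>UNIV. (\<pi>\<^sub>S v a $ k + v $ i $ k)\<^sup>2) = 0" by simp
    then have z: "\<pi>\<^sub>S v a $ k + v $ i $ k = 0" for k
      by (subst (asm) sum_nonneg_eq_0_iff) auto
    have "\<pi>\<^sub>S v (a + std i) $ k = (\<Sum>l\<in>UNIV. a $ l * v $ l $ k + (if l = i then v $ i $ k else 0))" for k
      unfolding \<pi>\<^sub>S_def by (simp add: sum_component algebra_simps) (auto intro!: sum.cong simp: axis_def)
    then have "\<pi>\<^sub>S v (a + std i) $ k = \<pi>\<^sub>S v a $ k + v $ i $ k" for k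
      by (simp add: sum.distrib \<pi>\<^sub>S_def)
    then have "a + std i \<in> \<Theta> v" using z by (simp add: \<Theta>_def vec_eq_iff)
    moreover have "translation_part (Pos a) = - std i + (a + std i)" by simp
    ultimately show False using V unfolding vertices_def by blast
  qed
  have G: "u \<in> G1" "w \<in> G1" using V by (auto simp: vertices_def)
  define s where "s = lab w $ i - lab u $ i"
  have d': "lab w = lab u + s *s std i" using d(2) by (auto simp: vec_eq_iff axis_def s_def)
  have s: "s = 2 \<or> s = - 2" using d(1) by (auto simp: s_def)
  have "\<eta> (lab w) = \<eta> (lab u) + s"
    unfolding d' by (simp add: \<eta>_add \<eta>_std \<eta>_scale)
  \<comment> \<open>A total change of \<open>\<eta>\<close> by 2 or -2 forces the two vertices to
    have opposite signs.\<close>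
  then have sg: "gsign u - gsign w = s" using \<eta>_lab[OF G(1)] \<eta>_lab[OF G(2)] by simp
  show False
  proof (cases u; cases w)
    fix a b assume u: "u = Pos a" "w = Neg b"
    then have "b = - a - 2 *s std i" using d' sg by (simp add: minus_equation_iff[of b] algebra_simps)
    then show False using main V K u by blast
  next
    fix a b assume u: "u = Neg a" "w = Pos b"
    then have "b = - a + (- 2) *s std i" using d' sg by simp
    then have "a = - b - 2 *s std i" by (simp add: vec_eq_iff)
    then show False using main V K u by metis
  qed (use sg s in auto)
qed

section \<open>Finiteness and uniform size of the components\<close>

lemma component_energy:
  assumes "(u, w) \<in> (adj v)\<^sup>*"
  shows "K v w = K v u"
  using assms by (induction rule: rtrancl_induct) (auto simp: adj_def edge_def)

lemma component_vertices:
  assumes "(u, w) \<in> (adj v)\<^sup>*" "u \<in> vertices v"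
  shows "w \<in> vertices v"
  using assms by (induction rule: rtrancl_induct) (auto simp: adj_def edge_def)

fun reach :: "('a \<times> 'a) set \<Rightarrow> 'a \<Rightarrow> nat \<Rightarrow> 'a set" where
  "reach r u 0 = {u}"
| "reach r u (Suc k) = reach r u k \<union> r `` reach r u k"

lemma reach_subset: "reach r u k \<subseteq> r\<^sup>* `` {u}"
  by (induction k) (auto intro: rtrancl_into_rtrancl)

text \<open>Until the balls around \<open>u\<close> stop growing, each increase of the radius adds a
  vertex, so an unsaturated ball of radius \<open>k\<close> has more than \<open>k\<close>
  elements.\<close>

lemma reach_saturates:
  assumes "finite (reach r u n)" "card (reach r u n) \<le> n"
  shows "r\<^sup>* `` {u} \<subseteq> reach r u n"
proof -
  have "finite (reach r u k) \<longrightarrow> r\<^sup>* `` {u} \<subseteq> reach r u k \<or> card (reach r u k) > k" for k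
  proof (induction k)
    case (Suc k)
    show ?case
    proof (cases "r `` reach r u k \<subseteq> reach r u k")
      case True
      have "u \<in> reach r u k" by (induction k) auto
      then have "r\<^sup>* `` {u} \<subseteq> reach r u k" using Image_closed_trancl[OF True] by blast
      then show ?thesis by auto
    next
      case False
      then have "reach r u k \<subset> reach r u (Suc k)" by auto
      then have "finite (reach r u (Suc k)) \<Longrightarrow> finite (reach r u k) \<and> card (reach r u k) < card (reach r u (Suc k))"
        by (meson finite_subset psubset_card_mono psubset_imp_subset)
      then show ?thesis using Suc by fastforce
    qed
  qed simp
  then show ?thesis using assms by force
qed

lemma finite_int_box: "finite {g :: int ^ ('m::finite). \<forall>i. \<bar>g $ i\<bar> \<le> n}"
proof (rule finite_subset)
  show "{g :: int ^ 'm. \<forall>i. \<bar>g $ i\<bar> \<le> n} \<subseteq> vec_lambda ` (UNIV \<rightarrow>\<^sub>E {-n..n})"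
  proof
    fix g :: "int ^ 'm" assume "g \<in> {g. \<forall>i. \<bar>g $ i\<bar> \<le> n}"
    then have "vec_nth g \<in> UNIV \<rightarrow>\<^sub>E {-n..n}" by (auto simp: abs_le_iff) (metis minus_le_iff)
    then show "g \<in> vec_lambda ` (UNIV \<rightarrow>\<^sub>E {-n..n})" by (intro image_eqI[of _ _ "vec_nth g"]) simp_all
  qed
qed (intro finite_imageI finite_PiE; simp)

lemma reach_lab:
  assumes "w \<in> reach (adj v) u k" shows "\<bar>lab w $ i - lab u $ i\<bar> \<le> int k"
  using assms
proof (induction k arbitrary: w)
  case (Suc k)
  then consider "w \<in> reach (adj v) u k" | x where "x \<in> reach (adj v) u k" "(x, w) \<in> adj v" by auto
  then show ?case
  proof cases
    case 2
    then obtain y where "edge v y x w" by (auto simp: adj_def)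
    then obtain p q where "nbr p q (lab x) (lab w)" using edge_nbr by blast
    then have "\<bar>lab w $ i - lab x $ i\<bar> \<le> 1" by (cases "i = p \<or> i = q") (auto simp: nbr_def)
    then show ?thesis using Suc.IH[OF 2(1)] by linarith
  qed (use Suc in fastforce)
qed simp

text \<open>The genericity condition covers only differences in a fixed box, so it is applied to the
  ball of radius \<open>N\<close>, not to the component. That ball has at most
  \<open>CARD('m) + 1\<close> vertices of each sign, hence at most \<open>N\<close> in total, and is
  therefore the whole component.\<close>

lemma component_bounded:
  fixes v :: "int ^ ('n::finite) ^ ('m::finite)"
  defines "N \<equiv> 2 * (CARD('m) + 1)"
  assumes gen: "\<And>G. G \<subseteq> {g. \<forall>i. \<bar>g $ i\<bar> \<le> 2 * int N} \<Longrightarrow> 0 \<notin> G \<Longrightarrow> card G > CARD('m) \<Longrightarrow>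
        \<exists>c. (\<forall>i. (\<Sum>g\<in>G. c g * of_int (g $ i)) = (0::real))
          \<and> (\<Sum>g\<in>G. c g * of_int (sqnorm (\<pi>\<^sub>S v g))) \<noteq> 0"
    and u: "u \<in> vertices v"
  shows "finite ((adj v)\<^sup>* `` {u})"
    and "\<And>w i. (u, w) \<in> (adj v)\<^sup>* \<Longrightarrow> \<bar>lab w $ i - lab u $ i\<bar> \<le> int N"
proof -
  define S where "S = reach (adj v) u N"
  have SR: "(u, w) \<in> (adj v)\<^sup>*" if "w \<in> S" for w using subsetD[OF reach_subset that[unfolded S_def]] by simp
  have SG: "S \<subseteq> G1" using component_vertices[OF SR u] by (auto simp: vertices_def)
  have tp: "\<bar>translation_part a $ i - translation_part b $ i\<bar> \<le> 2 * int N"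
    if "a \<in> S" "b \<in> S" "gsign a = gsign b" for a b i
    using reach_lab[OF that(1)[unfolded S_def], of i] reach_lab[OF that(2)[unfolded S_def], of i] that(3) by (cases a; cases b) auto
  have "lab ` S \<subseteq> (\<lambda>g. g + lab u) ` {g. \<forall>i. \<bar>g $ i\<bar> \<le> int N}"
  proof
    fix x assume "x \<in> lab ` S"
    then have "x - lab u \<in> {g. \<forall>i. \<bar>g $ i\<bar> \<le> int N}" using reach_lab by (auto simp: S_def)
    then show "x \<in> (\<lambda>g. g + lab u) ` {g. \<forall>i. \<bar>g $ i\<bar> \<le> int N}" by (intro image_eqI[of _ _ "x - lab u"]) simp_all
  qed
  then have "finite (lab ` S)" by (rule finite_subset) (intro finite_imageI finite_int_box)
  then have fin: "finite S" using inj_on_subset[OF inj_on_lab SG] by (rule finite_imageD)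
  have half: "card {w \<in> S. gsign w = s} \<le> CARD('m) + 1" if s: "s = 1 \<or> s = - 1" for s
  proof -
    have "inj_on translation_part {w \<in> S. gsign w = s}"
    proof (rule inj_onI)
      fix a b assume "a \<in> {w \<in> S. gsign w = s}" "b \<in> {w \<in> S. gsign w = s}" "translation_part a = translation_part b"
      then show "a = b" by (cases a; cases b) auto
    qed
    then have "card {w \<in> S. gsign w = s} = card (translation_part ` {w \<in> S. gsign w = s})"
      by (rule card_image[symmetric])
    also have "\<dots> \<le> CARD('m) + 1"
    proof (rule energy_card_le[OF gen])
      fix a assume "a \<in> translation_part ` {w \<in> S. gsign w = s}"
      then obtain w where w: "w \<in> S" "gsign w = s" "a = translation_part w" by blast
      have "K v w = K v u" by (rule component_energy[OF SR[OF w(1)]])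
      then have "of_int (sqnorm (\<pi>\<^sub>S v a) + (\<Sum>i\<in>UNIV. a $ i * sqnorm (v $ i))) = s * 2 * K v u"
        using s w by (auto simp: K_def Let_def)
      \<comment> \<open>\<open>energy_card_le\<close> asks for one integer value, while
        \<open>K\<close> is real; the floor converts it.\<close>
      then show "sqnorm (\<pi>\<^sub>S v a) + (\<Sum>i\<in>UNIV. a $ i * sqnorm (v $ i)) = \<lfloor>s * 2 * K v u\<rfloor>"
        by (metis floor_of_int)
    qed (use tp in auto)
    finally show ?thesis .
  qed
  have "S = {w \<in> S. gsign w = 1} \<union> {w \<in> S. gsign w = - 1}" using gsign_cases by blast
  then have "card S \<le> card {w \<in> S. gsign w = 1} + card {w \<in> S. gsign w = - 1}"
    by (metis card_Un_le)
  then have "card S \<le> N" using half[of 1] half[of "- 1"] by (simp add: N_def)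
  from reach_saturates[OF fin[unfolded S_def] this[unfolded S_def], folded S_def] have sat: "(adj v)\<^sup>* `` {u} \<subseteq> S" .
  then show "finite ((adj v)\<^sup>* `` {u})" using fin by (rule finite_subset)
  show "\<bar>lab w $ i - lab u $ i\<bar> \<le> int N" if "(u, w) \<in> (adj v)\<^sup>*" for w i
    using reach_lab[of w v u N i] subsetD[OF sat, of w] that by (simp add: S_def)
qed

section \<open>Reality of the eigenvalues\<close>

text \<open>Arguments are labels relative to a base vertex of sign \<open>s\<close>, so that \<open>s - \<eta> b\<close> is the sign of the
  vertex labelled \<open>b\<close>. Both orders of the pair \<open>i, j\<close> contribute, which accounts for the factor 2 in
  the entries of \<open>Q\<close>.\<close>

definition nls_coef :: "int \<Rightarrow> ('m::finite) coef" where
  "nls_coef s a b i j = (if a = b then if i = j then - of_int (a $ i) else 0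
     else if nbr i j a b then of_int (s - \<eta> b) else 0)"

lemma good_nls_coef:
  fixes L :: "(int ^ ('m::finite)) set"
  assumes "finite L" "\<And>a b i. a \<in> L \<Longrightarrow> b \<in> L \<Longrightarrow> \<bar>b $ i - a $ i\<bar> = 2 \<Longrightarrow> \<exists>l. l \<noteq> i \<and> b $ l \<noteq> a $ l"
  shows "good UNIV L (nls_coef s)"
  unfolding good_def
proof (intro conjI ballI impI)
  fix a b :: "int ^ 'm" and i j :: 'm assume "i \<noteq> j"
  have "nls_coef s a b i j + nls_coef s a b j i = of_int (2 * (if a \<noteq> b \<and> nbr i j a b then s - \<eta> b else 0))"
    using \<open>i \<noteq> j\<close> by (auto simp: nls_coef_def nbr_swap[of j i])
  then show "loc_mult 2 (nls_coef s a b i j + nls_coef s a b j i)" by (simp only: loc_mult_int)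
qed (use assms in \<open>auto simp: nls_coef_def loc_mult_0 split: if_splits\<close>)

lemma Q_alt:
  "Q v \<xi> u w = (if u = w then K v u - (\<Sum>j\<in>UNIV. of_int (lab u $ j) * \<xi> $ j)
     else of_int (gsign w) * coupling v \<xi> u w)"
  by (cases u; cases w) (simp_all add: sum_negf)

text \<open>Constant energy makes the remaining diagonal part a scalar. Labels are taken relative to
  \<open>u0\<close> so that only finitely many systems occur for all components and all
  \<open>v\<close> together.\<close>

lemma Q_nls_coef:
  fixes v :: "int ^ ('n::finite) ^ ('m::finite)"
  assumes \<xi>: "\<And>i. \<xi> $ i > 0" and V: "u0 \<in> vertices v" "u \<in> vertices v" "w \<in> vertices v"
    and K: "K v u = \<kappa>" "K v w = \<kappa>"
  shows "Q v \<xi> u w = (if u = w then \<kappa> - (\<Sum>j\<in>UNIV. of_int (lab u0 $ j) * \<xi> $ j) else 0)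
    + sysmat UNIV (sqrt \<circ> (vec_nth \<xi>)) (nls_coef (gsign u0)) (lab u - lab u0) (lab w - lab u0)"
proof -
  have G: "u0 \<in> G1" "u \<in> G1" "w \<in> G1" using V by (auto simp: vertices_def)
  have n: "nbr i j (lab u - lab u0) (lab w - lab u0) \<longleftrightarrow> nbr i j (lab u) (lab w)" for i j
    by (simp add: nbr_def)
  show ?thesis
  proof (cases "u = w")
    case True
    have "sysmat UNIV (sqrt \<circ> (vec_nth \<xi>)) (nls_coef (gsign u0)) (lab u - lab u0) (lab u - lab u0)
        = (\<Sum>i\<in>UNIV. \<Sum>j\<in>UNIV. if j = i then - of_int ((lab u - lab u0) $ i) * \<xi> $ i else 0)"
      unfolding sysmat_def nls_coef_def using \<xi> by (intro sum.cong refl) (auto simp: less_imp_le)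
    also have "\<dots> = (\<Sum>j\<in>UNIV. of_int (lab u0 $ j) * \<xi> $ j) - (\<Sum>j\<in>UNIV. of_int (lab u $ j) * \<xi> $ j)"
      by (simp add: left_diff_distrib sum_subtractf)
    finally show ?thesis using True K by (simp add: Q_alt)
  next
    case False
    then have ne: "lab u - lab u0 \<noteq> lab w - lab u0" using inj_on_lab G by (auto simp: inj_on_def)
    have sw: "gsign u0 - \<eta> (lab w - lab u0) = gsign w"
      using \<eta>_lab[OF G(1)] \<eta>_lab[OF G(3)] by (simp add: \<eta>_diff)
    have M: "sysmat UNIV (sqrt \<circ> (vec_nth \<xi>)) (nls_coef (gsign u0)) (lab u - lab u0) (lab w - lab u0)
        = (\<Sum>p\<in>UNIV. \<Sum>q\<in>UNIV. if nbr p q (lab u) (lab w) then of_int (gsign w) * sqrt (\<xi> $ p) * sqrt (\<xi> $ q) else 0)"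
      unfolding sysmat_def nls_coef_def sw n using ne by (intro sum.cong refl) auto
    show ?thesis
    proof (cases "\<exists>i j. nbr i j (lab u) (lab w)")
      case True
      then obtain i j where ij: "nbr i j (lab u) (lab w)" by blast
      then have neq: "i \<noteq> j" by (simp add: nbr_def)
      have iff: "nbr p q (lab u) (lab w) \<longleftrightarrow> p = i \<and> q = j \<or> p = j \<and> q = i" for p q
        using nbr_unique[OF ij] ij nbr_swap by blast
      have "(\<Sum>p\<in>UNIV. \<Sum>q\<in>UNIV. if nbr p q (lab u) (lab w) then of_int (gsign w) * sqrt (\<xi> $ p) * sqrt (\<xi> $ q) else 0)
         = (\<Sum>p\<in>UNIV. \<Sum>q\<in>UNIV. (if p = i then if q = j then of_int (gsign w) * sqrt (\<xi> $ i) * sqrt (\<xi> $ j) else 0 else 0)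
             + (if p = j then if q = i then of_int (gsign w) * sqrt (\<xi> $ i) * sqrt (\<xi> $ j) else 0 else 0))"
        unfolding iff using neq by (intro sum.cong refl) auto
      also have "\<dots> = of_int (gsign w) * (2 * sqrt (\<xi> $ i * \<xi> $ j))"
        by (simp add: sum.distrib real_sqrt_mult if_distrib[where f = "\<lambda>F. sum F _"] sum.If_cases)
      finally show ?thesis
        using False M coupling_nbr[OF ij V(2,3)] K by (simp add: Q_alt)
    next
      case no: False
      then show ?thesis using False M coupling_not_nbr[of u w v \<xi>] by (simp add: Q_alt)
    qed
  qed
qed

section \<open>Indefinite signature and non-real eigenvalues\<close>

lemma coupling_sym:
  assumes V: "u \<in> vertices v" "w \<in> vertices v" and K: "K v u = K v w"
  shows "coupling v \<xi> u w = coupling v \<xi> w u"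
proof (cases "\<exists>i j. nbr i j (lab u) (lab w)")
  case True
  then obtain i j where "nbr i j (lab u) (lab w)" by blast
  then show ?thesis using coupling_nbr[of i j u w] coupling_nbr[of i j w u] nbr_sym V K by metis
next
  case False
  then show ?thesis using coupling_not_nbr nbr_sym by metis
qed

text \<open>Multiplication by the row signs makes the block symmetric, so its Hermitian form
  \<open>H\<close> at \<open>f\<close> is real. The eigenvalue equation gives
  \<open>H = c * S\<close> with real \<open>S\<close>, which for non-real \<open>c\<close> leaves
  only \<open>S = 0\<close>.\<close>

lemma signature_orthogonal:
  fixes v :: "int ^ ('n::finite) ^ ('m::finite)" and f :: "'m grp \<Rightarrow> complex"
  assumes fin: "finite C" and V: "C \<subseteq> vertices v" and K: "\<And>u. u \<in> C \<Longrightarrow> K v u = \<kappa>"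
    and eig: "\<And>u. u \<in> C \<Longrightarrow> (\<Sum>w\<in>C. of_real (Q v \<xi> u w) * f w) = c * f u" and c: "c \<notin> \<real>"
  shows "(\<Sum>u\<in>C. of_int (gsign u) * (cmod (f u))\<^sup>2) = 0"
proof -
  define h where "h u w = of_int (gsign u) * Q v \<xi> u w" for u w
  define S where "S = (\<Sum>u\<in>C. of_int (gsign u) * (cmod (f u))\<^sup>2)"
  have sym: "h u w = h w u" if "u \<in> C" "w \<in> C" for u w
    using coupling_sym[of u v w \<xi>] that V K by (auto simp: h_def Q_alt)
  define H where "H = (\<Sum>u\<in>C. \<Sum>w\<in>C. of_real (h u w) * (cnj (f u) * f w))"
  have "H = (\<Sum>u\<in>C. of_int (gsign u) * cnj (f u) * (\<Sum>w\<in>C. of_real (Q v \<xi> u w) * f w))"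
    by (simp add: H_def h_def sum_distrib_left mult_ac)
  also have "\<dots> = (\<Sum>u\<in>C. c * of_real (of_int (gsign u) * (cmod (f u))\<^sup>2))"
    by (intro sum.cong refl, subst eig) (simp_all add: complex_norm_square mult_ac del: of_real_power)
  also have "\<dots> = c * of_real S" by (simp add: S_def sum_distrib_left)
  finally have 1: "H = c * of_real S" .
  have "cnj H = (\<Sum>u\<in>C. \<Sum>w\<in>C. of_real (h w u) * (cnj (f w) * f u))"
    unfolding H_def cnj_sum by (intro sum.cong refl) (simp add: sym mult_ac)
  also have "\<dots> = H" unfolding H_def by (rule sum.swap)
  finally have "cnj c * of_real S = c * of_real S" using 1 by (metis complex_cnj_complex_of_real complex_cnj_mult)
  then have "S = 0" using c Reals_cnj_iff by auto
  then show ?thesis by (simp add: S_def)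
qed

text \<open>Relative to the sign of \<open>u\<close>, the vertex \<open>u\<close> contributes 1,
  other vertices of that sign contribute nonnegatively, and those of opposite sign remove at most
  \<open>card C * \<theta>^2\<close> in total, which is less than 1.\<close>

lemma indefinite_contradiction:
  fixes f :: "'a \<Rightarrow> complex" and s :: "'a \<Rightarrow> int"
  assumes fin: "finite C" and s: "\<And>u. s u = 1 \<or> s u = - 1"
    and sum0: "(\<Sum>u\<in>C. of_int (s u) * (cmod (f u))\<^sup>2) = 0"
    and u: "u \<in> C" "cmod (f u) = 1"
    and small: "\<And>w. w \<in> C \<Longrightarrow> s w \<noteq> s u \<Longrightarrow> cmod (f w) \<le> \<theta>" and \<theta>: "real (card C) * \<theta>\<^sup>2 < 1"
  shows False
proof -
  have "(\<Sum>w\<in>C. (if w = u then 1 else 0) - \<theta>\<^sup>2) \<le> (\<Sum>w\<in>C. of_int (s u) * (of_int (s w) * (cmod (f w))\<^sup>2))"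
  proof (rule sum_mono)
    fix w assume w: "w \<in> C"
    show "(if w = u then 1 else 0) - \<theta>\<^sup>2 \<le> of_int (s u) * (of_int (s w) * (cmod (f w))\<^sup>2)"
    proof (cases "s w = s u")
      case True
      then have eq: "of_int (s u) * (of_int (s w) * (cmod (f w))\<^sup>2) = (cmod (f w))\<^sup>2" using s[of u] by auto
      have "0 \<le> (cmod (f w))\<^sup>2" "0 \<le> \<theta>\<^sup>2" by simp_all
      then show ?thesis unfolding eq using u(2) by (cases "w = u") (auto intro: order_trans[of _ 0])
    next
      case False
      then have eq: "of_int (s u) * (of_int (s w) * (cmod (f w))\<^sup>2) = - (cmod (f w))\<^sup>2" using s[of u] s[of w] by auto
      have "(cmod (f w))\<^sup>2 \<le> \<theta>\<^sup>2" using small[OF w False] by (simp add: power_mono)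
      then show ?thesis unfolding eq using False by auto
    qed
  qed
  also have "\<dots> = 0" using sum0 by (simp flip: sum_distrib_left)
  finally show False using \<theta> u fin by (simp add: sum_subtractf)
qed

theorem proposition1p3:
  "\<exists>P :: ('m::finite \<times> 'n::finite) mpoly_real. P \<noteq> 0 \<and>
     (\<forall>v :: int ^ 'n ^ 'm. mpoly_eval P (\<lambda>(i, k). of_int (v $ i $ k)) \<noteq> 0 \<longrightarrow>
        (\<exists>U :: (real ^ 'm) set. open U \<and> U \<noteq> {} \<and> U \<subseteq> {\<xi>. \<forall>i. \<xi> $ i > 0} \<and>
           (\<forall>\<xi>\<in>U. Q_eigenvalues v \<xi> \<subseteq> \<real>)))"
proof -
  \<comment> \<open>\<open>N\<close> bounds the size of a component, and \<open>D\<close> contains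
    both the differences used for genericity and the labels relative to a base vertex.\<close>
  define N where "N = 2 * (CARD('m) + 1)"
  define D :: "(int ^ 'm) set" where "D = {g. \<forall>i. \<bar>g $ i\<bar> \<le> 2 * int N}"
  have finD: "finite D" unfolding D_def by (rule finite_int_box)
  obtain P :: "('m \<times> 'n) mpoly_real" where P: "P \<noteq> 0"
    and gen: "\<And>v G. mpoly_eval P (\<lambda>(i, k). of_int (v $ i $ k)) \<noteq> 0 \<Longrightarrow> G \<subseteq> D \<Longrightarrow> 0 \<notin> G \<Longrightarrow> card G > CARD('m) \<Longrightarrow>
        \<exists>c. (\<forall>i. (\<Sum>g\<in>G. c g * of_int (g $ i)) = (0::real))
          \<and> (\<Sum>g\<in>G. c g * of_int (sqnorm (\<pi>\<^sub>S v g))) \<noteq> 0"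
    using generic_polynomial[OF finD, where 'n = 'n] by (elim exE conjE) blast
  \<comment> \<open>A finite family depending only on \<open>CARD('m)\<close>: relative labels lie
    in \<open>D\<close> and the base vertex has one of two signs. Thus one box of parameters serves
    every generic \<open>v\<close>.\<close>
  define \<F> :: "((int ^ 'm) set \<times> 'm coef) set"
    where "\<F> = {(L, A). (L, A) \<in> Pow D \<times> {nls_coef 1, nls_coef (- 1)} \<and> good UNIV L A}"
  have finF: "finite \<F>" unfolding \<F>_def
    by (rule finite_subset[of _ "Pow D \<times> {nls_coef 1, nls_coef (- 1)}"]) (use finD in auto)
  \<comment> \<open>Chosen such that \<open>card D * \<theta>^2 < 1\<close>, as
    \<open>indefinite_contradiction\<close> requires.\<close>
  define \<theta> where "\<theta> = 1 / (real (card D) + 1)"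
  have \<theta>: "\<theta> > 0" by (simp add: \<theta>_def add_nonneg_pos)
  have \<theta>D: "real k * \<theta>\<^sup>2 < 1" if "k \<le> card D" for k
  proof -
    have "0 \<le> real (card D) * real (card D)" "real k \<le> real (card D)" using that by simp_all
    then have "real k < (real (card D) + 1) * (real (card D) + 1)" unfolding distrib_left distrib_right by linarith
    then show ?thesis by (simp add: \<theta>_def power2_eq_square field_simps)
  qed
  have gF: "good UNIV L A" if "(L, A) \<in> \<F>" for L A using that by (simp add: \<F>_def)
  obtain l h :: "'m \<Rightarrow> real" and \<delta> where lh: "\<forall>i. 0 < l i \<and> l i < h i" and \<delta>: "0 < \<delta>"
    and conc: "\<And>L A \<xi>. (L, A) \<in> \<F> \<Longrightarrow> \<forall>i\<in>UNIV. l i < \<xi> i \<and> \<xi> i < h i \<Longrightarrow> concentrated UNIV \<xi> L A \<theta> \<delta>"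
    using hierarchy[OF finite finF gF \<theta>] by blast
  define U :: "(real ^ 'm) set" where "U = box (\<chi> i. l i) (\<chi> i. h i)"
  have U: "\<xi> \<in> U \<longleftrightarrow> (\<forall>i. l i < \<xi> $ i \<and> \<xi> $ i < h i)" for \<xi> by (simp add: U_def mem_box_cart)
  have "(\<chi> i. (l i + h i) / 2) \<in> U" using lh by (simp add: U)
  then have Une: "U \<noteq> {}" by blast
  have Upos: "U \<subseteq> {\<xi>. \<forall>i. \<xi> $ i > 0}"
  proof (intro subsetI CollectI allI)
    fix \<xi> i assume "\<xi> \<in> U"
    then have "l i < \<xi> $ i" by (simp add: U)
    then show "0 < \<xi> $ i" using lh by (meson order.strict_trans)
  qed
  have "c \<in> \<real>" if v: "mpoly_eval P (\<lambda>(i, k). of_int (v $ i $ k)) \<noteq> 0" and \<xi>: "\<xi> \<in> U" and ev: "c \<in> Q_eigenvalues v \<xi>"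
    for v :: "int ^ 'n ^ 'm" and \<xi> c
  proof (rule ccontr)
    assume cR: "c \<notin> \<real>"
    obtain u0 where u0: "u0 \<in> vertices v" and be: "block_eigenvalue v \<xi> {w. (u0, w) \<in> (adj v)\<^sup>*} c"
      using ev by (auto simp: Q_eigenvalues_def components_def)
    define C where "C = {w. (u0, w) \<in> (adj v)\<^sup>*}"
    have CI: "C = (adj v)\<^sup>* `` {u0}" by (auto simp: C_def)
    have finC: "finite C"
      unfolding CI by (rule component_bounded(1)[OF gen[OF v] u0]) (auto simp: D_def N_def)
    have bd: "\<bar>lab w $ i - lab u0 $ i\<bar> \<le> int N" if "w \<in> C" for w i
      unfolding N_def
      by (rule component_bounded(2)[OF gen[OF v] u0]) (use that in \<open>auto simp: D_def N_def C_def\<close>)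
    have CV: "w \<in> vertices v" if "w \<in> C" for w using component_vertices[of u0 w v] u0 that by (simp add: C_def)
    then have CG: "C \<subseteq> G1" by (auto simp: vertices_def)
    have CK: "K v w = K v u0" if "w \<in> C" for w using component_energy[of u0 w v] that by (simp add: C_def)
    obtain f where f: "{w. f w \<noteq> 0} \<subseteq> C" "\<exists>w. f w \<noteq> 0"
      and fe: "\<And>u. u \<in> C \<Longrightarrow> (\<Sum>w | f w \<noteq> 0. of_real (Q v \<xi> u w) * f w) = c * f u"
      using be by (auto simp: block_eigenvalue_def C_def)
    \<comment> \<open>Dividing by the maximal modulus gives the normalization demanded by
      \<open>concentrated\<close>.\<close>
    define M where "M = Max (cmod ` f ` C)"
    have Cne: "C \<noteq> {}" using f by auto
    have "M \<in> cmod ` f ` C" unfolding M_def by (rule Max_in) (use finC Cne in auto)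
    then obtain u1 where u1: "u1 \<in> C" "cmod (f u1) = M" by auto
    have fM: "cmod (f w) \<le> M" if "w \<in> C" for w unfolding M_def by (rule Max_ge) (use finC that in auto)
    obtain w0 where w0: "f w0 \<noteq> 0" using f(2) by blast
    then have "cmod (f w0) \<le> M" "cmod (f w0) > 0" using fM f(1) by auto
    then have M: "M > 0" by linarith
    define g where "g w = f w / of_real M" for w
    have ge: "(\<Sum>w\<in>C. of_real (Q v \<xi> u w) * g w) = c * g u" if "u \<in> C" for u
    proof -
      have "(\<Sum>w\<in>C. of_real (Q v \<xi> u w) * f w) = (\<Sum>w | f w \<noteq> 0. of_real (Q v \<xi> u w) * f w)"
        by (rule sum.mono_neutral_right) (use finC f(1) in auto)
      then have "(\<Sum>w\<in>C. of_real (Q v \<xi> u w) * f w) = c * f u" using fe[OF that] by simp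
      then show ?thesis by (simp add: g_def flip: sum_divide_distrib)
    qed
    have g1: "cmod (g w) \<le> 1" if "w \<in> C" for w using fM[OF that] M by (simp add: g_def norm_divide)
    have gu1: "cmod (g u1) = 1" using u1 M by (simp add: g_def norm_divide)
    have sig: "(\<Sum>u\<in>C. of_int (gsign u) * (cmod (g u))\<^sup>2) = 0"
      by (rule signature_orthogonal[OF finC _ CK ge cR]) (use CV in auto)
    define \<phi> where "\<phi> w = lab w - lab u0" for w
    define L where "L = \<phi> ` C"
    have inj: "inj_on \<phi> C" using inj_on_subset[OF inj_on_lab CG] by (auto simp: \<phi>_def inj_on_def)
    have LD: "L \<subseteq> D"
    proof
      fix a assume "a \<in> L"
      then obtain w where w: "w \<in> C" "a = lab w - lab u0" by (auto simp: L_def \<phi>_def)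
      have "\<bar>a $ i\<bar> \<le> 2 * int N" for i using bd[OF w(1), of i] by (simp add: w(2))
      then show "a \<in> D" by (simp add: D_def)
    qed
    have good: "good UNIV L (nls_coef (gsign u0))"
    proof (rule good_nls_coef)
      show "finite L" using finC by (simp add: L_def)
      fix a b i assume "a \<in> L" "b \<in> L" and d: "\<bar>b $ i - a $ i\<bar> = 2"
      then obtain u w where uw: "u \<in> C" "w \<in> C" "a = \<phi> u" "b = \<phi> w" by (auto simp: L_def)
      show "\<exists>l. l \<noteq> i \<and> b $ l \<noteq> a $ l"
        using no_double_step[OF CV[OF uw(1)] CV[OF uw(2)], of i] CK uw d by (auto simp: \<phi>_def)
    qed
    have "(L, nls_coef (gsign u0)) \<in> \<F>" using good LD gsign_cases[of u0] by (auto simp: \<F>_def)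
    then have cc: "concentrated UNIV (vec_nth \<xi>) L (nls_coef (gsign u0)) \<theta> \<delta>"
      by (rule conc) (use \<xi> in \<open>simp add: U\<close>)
    define f' where "f' = g \<circ> inv_into C \<phi>"
    have f': "f' (\<phi> w) = g w" if "w \<in> C" for w using inj that by (simp add: f'_def)
    define \<mu> where "\<mu> = c - of_real (K v u0 - (\<Sum>j\<in>UNIV. of_int (lab u0 $ j) * \<xi> $ j))"
    have ae: "approx_eig UNIV (sqrt \<circ> vec_nth \<xi>) L (nls_coef (gsign u0)) f' \<mu> \<delta>"
      unfolding approx_eig_def
    proof
      fix a assume "a \<in> L"
      then obtain u where u: "u \<in> C" "a = \<phi> u" by (auto simp: L_def)
      let ?M = "sysmat UNIV (sqrt \<circ> vec_nth \<xi>) (nls_coef (gsign u0))"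
      let ?k = "K v u0 - (\<Sum>j\<in>UNIV. of_int (lab u0 $ j) * \<xi> $ j)"
      have \<xi>0: "\<xi> $ i > 0" for i using \<xi> Upos by auto
      have "c * g u = (\<Sum>w\<in>C. of_real (Q v \<xi> u w) * g w)" using ge[OF u(1)] by simp
      also have "\<dots> = (\<Sum>w\<in>C. (if w = u then of_real ?k * g u else 0) + of_real (?M (\<phi> u) (\<phi> w)) * g w)"
        by (intro sum.cong refl)
          (use Q_nls_coef[OF \<xi>0 u0 CV CV CK CK] u(1) in \<open>auto simp: \<phi>_def algebra_simps\<close>)
      also have "\<dots> = of_real ?k * g u + (\<Sum>w\<in>C. of_real (?M (\<phi> u) (\<phi> w)) * g w)"
        using finC u(1) by (simp add: sum.distrib)
      also have "(\<Sum>w\<in>C. of_real (?M (\<phi> u) (\<phi> w)) * g w) = (\<Sum>b\<in>L. of_real (?M a b) * f' b)"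
        unfolding L_def sum.reindex[OF inj] u(2) by (intro sum.cong refl) (simp add: f')
      finally have "(\<Sum>b\<in>L. of_real (?M a b) * f' b) - \<mu> * f' a = 0"
        using f'[OF u(1)] u(2) by (simp add: \<mu>_def algebra_simps)
      then show "cmod ((\<Sum>b\<in>L. of_real (?M a b) * f' b) - \<mu> * f' a) \<le> \<delta>" using \<delta> by simp
    qed
    have "\<forall>a\<in>L. cmod (f' a) \<le> 1" using g1 by (auto simp: L_def f')
    moreover have "\<exists>a\<in>L. cmod (f' a) = 1" using u1(1) gu1 by (auto simp: L_def f')
    ultimately have "\<exists>a\<in>L. cmod (f' a) = 1 \<and>
        (\<forall>b\<in>L. (\<exists>i\<in>UNIV. \<not> 4 dvd b $ i - a $ i) \<longrightarrow> cmod (f' b) \<le> \<theta>)"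
      by (rule concentratedD[OF cc _ _ ae])
    then obtain a where a: "a \<in> L" "cmod (f' a) = 1"
      and small: "\<And>b. b \<in> L \<Longrightarrow> \<exists>i. \<not> 4 dvd b $ i - a $ i \<Longrightarrow> cmod (f' b) \<le> \<theta>" by auto
    obtain u where u: "u \<in> C" "a = \<phi> u" using a(1) by (auto simp: L_def)
    show False
    proof (rule indefinite_contradiction[OF finC gsign_cases sig u(1), where \<theta> = \<theta>])
      show "cmod (g u) = 1" using a(2) u f' by simp
      have "card C = card L" unfolding L_def using card_image[OF inj] by simp
      also have "\<dots> \<le> card D" using LD finD by (rule card_mono[rotated])
      finally show "real (card C) * \<theta>\<^sup>2 < 1" by (rule \<theta>D)
      fix w assume w: "w \<in> C" "gsign w \<noteq> gsign u"
      \<comment> \<open>If all coordinates agreed modulo 4, so would \<open>\<eta>\<close>; but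
        vertices of opposite sign have values of \<open>\<eta>\<close> differing by exactly
        2.\<close>
      have "\<exists>i. \<not> 4 dvd \<phi> w $ i - \<phi> u $ i"
      proof (rule ccontr)
        assume "\<nexists>i. \<not> 4 dvd \<phi> w $ i - \<phi> u $ i"
        then have "4 dvd \<eta> (\<phi> w - \<phi> u)" unfolding \<eta>_def by (intro dvd_sum) simp
        moreover have "\<eta> (\<phi> w - \<phi> u) = gsign u - gsign w"
          using \<eta>_lab[OF subsetD[OF CG w(1)]] \<eta>_lab[OF subsetD[OF CG u(1)]] by (simp add: \<phi>_def \<eta>_diff)
        ultimately show False using w(2) gsign_cases[of u] gsign_cases[of w] by auto
      qed
      then have "cmod (f' (\<phi> w)) \<le> \<theta>" using small w(1) u(2) by (simp add: L_def)
      then show "cmod (g w) \<le> \<theta>" using f'[OF w(1)] by simp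
    qed
  qed
  then show ?thesis using P Une Upos open_box by (intro exI[of _ P]) (auto simp: U_def intro!: exI[of _ U])
qed

end
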